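(* Let $p\ge 1$ and $h$ be integers and let $f\in\mathcal F_{p,h}$. Let $U(x,\lambda)=\sum_{j=0}^p U_j(x)\lambda^{p-j}$ with $U_j(x)\in\mathcal D_{p-j}$ ($j=0,\dots,p$), and let $\Phi_\sigma=\Phi_\sigma(x)$ ($\sigma=1,\dots,r$) be real column solutions of $\Phi_{\sigma,x}=U(x,\lambda_\sigma)\Phi_\sigma$. Let $L(\lambda)$ be the Lax matrix built from $K\in\mathcal D_1$ (independent of $x$) and these $\Phi_\sigma$, and put $$\widetilde U(\lambda)=\big(\lambda^p f(L(\lambda))\big)_+ .$$ Then, under the constraint $U(\lambda)=\widetilde U(\lambda)$, $L(\lambda)$ satisfies $$L(\lambda)_x=[U(\lambda),L(\lambda)].$$ Moreover, writing $\widetilde U(\lambda)=\sum_{j=0}^p\widetilde U_j\lambda^{p-j}$, one has $\widetilde U_j\in\mathcal D_{p-j}$ for $j=0,\dots,p$.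
   Context: Algebraic setting. $W$ is a $2n\times 2n$ invertible antisymmetric real matrix. $G=\{A\in GL(2n,\mathbf C): A^TWA=W\}$ and $\mathfrak g=\{X\in gl(2n,\mathbf C): X^T=-WXW^{-1}\}$ is its Lie algebra. $\mathrm{pr}:G\to G/\{\pm I\}$ is the projection. $G_0$ is a finite subgroup of $G$ such that every $A\in G_0$ satisfies $\bar AA=\pm I$ (bar = entrywise complex conjugation); then $\mathrm{pr}(G_0)$ is Abelian. $\Omega_1,\dots,\Omega_N\in G_0$ are such that $\mathrm{pr}(\Omega_1),\dots,\mathrm{pr}(\Omega_N)$ generate $\mathrm{pr}(G_0)$, and $m_a$ is the order of $\mathrm{pr}(\Omega_a)$, so $\Omega_a^{m_a}=\pm I$. $m_0$ is the least common multiple of $m_1,\dots,m_N$. $\Sigma_0=\{\alpha=(\alpha_1,\dots,\alpha_N)\in\mathbf Z^N: 0\le\alpha_a<m_a\}$ and $\Omega^\alpha=\Omega_1^{\alpha_1}\cdots\Omega_N^{\alpha_N}$. $\omega:G_0\to S^1=\{z\in\mathbf C:|z|=1\}$ is a group homomorphism with $\omega(\pm I)=1$; $\omega_a=\omega(\Omega_a)$ and $\omega^\alpha=\omega_1^{\alpha_1}\cdots\omega_N^{\alpha_N}$. For an integer $k$, $\mathcal D_k=\{X\in\mathfrak g: \bar X=X,\ \Omega X\Omega^{-1}=\omega(\Omega)^kX\text{ for all }\Omega\in G_0\}$. For an integer $h$, $\Theta_h$ is the set of matrices $\theta=cg$ with $c\in S^1$, $g\in G_0$, such that $\bar\theta=\theta$,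 $\omega(g)=1$, $\theta^T=W\theta W^{-1}$, and $\Omega\theta\Omega^{-1}=\omega(\Omega)^h\theta$ for all $\Omega\in G_0$. For integers $p,h$, $\mathcal F_{p,h}$ is the set of matrix-valued polynomials $f(\tau)=\sum_{j=1}^s\theta f_{s-j}\tau^{j-1}$ with $s$ a positive integer, $\theta\in\Theta_h$, $f_{s-j}\in\mathbf R$, such that $f_{s-j}\neq0$ only when $j$ is even and $h+j\equiv p+1 \pmod{m_0}$. For a square matrix $X$, $f(X)=\sum_{j=1}^s f_{s-j}\theta X^{j-1}$. Lax matrix. $\lambda_1,\dots,\lambda_r$ are non-zero real numbers with $\lambda_1^2,\dots,\lambda_r^2$ distinct, $\kappa$ is a real constant, and $$L(\lambda)=K+\kappa\sum_{\alpha\in\Sigma_0}\sum_{\sigma=1}^r\frac{\Omega^\alpha\Phi_\sigma\Phi_\sigma^T(\Omega^\alpha)^TW}{\lambda-\omega^\alpha\lambda_\sigma}.$$ For a series $N(\lambda)=\sum_{j\le m}N_j\lambda^j$ (expansion at $\lambda=\infty$), $N(\lambda)_+=\sum_{0\le j\le m}N_j\lambda^j$. Subscript $x$ denotes the derivative in $x$. *)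

theory Defs
  imports
    "HOL-Complex_Analysis.Complex_Analysis"
    "HOL-Algebra.Generated_Groups"
    "HOL-Algebra.Multiplicative_Group"
    "HOL-Number_Theory.Cong"
begin

type_synonym 'n cmat = "complex^'n^'n"

text \<open>
  The multiplication and the power on \<^typ>\<open>complex^'n^'n\<close> provided by the type class
  hierarchy are componentwise, so neither is used here: products are \<open>(**)\<close>,
  and powers and complex multiples of matrices are introduced separately.
\<close>

abbreviation mat_cnj :: "complex^'n^'m \<Rightarrow> complex^'n^'m" where
  "mat_cnj \<equiv> map_matrix cnj"

definition mat_scale :: "complex \<Rightarrow> complex^'n^'m \<Rightarrow> complex^'n^'m" (infixr \<open>*\<^sub>M\<close> 75) where
  "c *\<^sub>M A = map_matrix (\<lambda>z. c * z) A"

primrec mat_pow :: "'n::finite cmat \<Rightarrow> nat \<Rightarrow> 'n cmat" where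
  "mat_pow A 0 = mat 1"
| "mat_pow A (Suc k) = A ** mat_pow A k"

definition outer :: "complex^'n \<Rightarrow> complex^'n \<Rightarrow> 'n cmat" where
  "outer v w = (\<chi> i j. v $ i * w $ j)"

definition symp_group :: "'n::finite cmat \<Rightarrow> 'n cmat monoid" where
  "symp_group W =
     \<lparr>carrier = {A. invertible A \<and> transpose A ** W ** A = W}, mult = (**), one = mat 1\<rparr>"

definition symp_alg :: "'n::finite cmat \<Rightarrow> 'n cmat set" where
  "symp_alg W = {X. transpose X = - (W ** X ** matrix_inv W)}"

definition circle_group :: "complex monoid" where
  "circle_group = \<lparr>carrier = {z. norm z = 1}, mult = (*), one = 1\<rparr>"

definition pmI :: "'n::finite cmat set" where
  "pmI = {mat 1, - mat 1}"

definition proj_group :: "'n::finite cmat \<Rightarrow> 'n cmat set monoid" where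
  "proj_group W = symp_group W Mod pmI"

definition pr :: "'n::finite cmat \<Rightarrow> 'n cmat \<Rightarrow> 'n cmat set" where
  "pr W A = pmI #>\<^bsub>symp_group W\<^esub> A"

definition Dspace :: "'n::finite cmat \<Rightarrow> 'n cmat set \<Rightarrow> ('n cmat \<Rightarrow> complex) \<Rightarrow> int \<Rightarrow> 'n cmat set"
  where
  "Dspace W G0 \<omega> k =
     {X \<in> symp_alg W. mat_cnj X = X \<and>
        (\<forall>A\<in>G0. A ** X ** matrix_inv A = (\<omega> A powi k) *\<^sub>M X)}"

definition Theta :: "'n::finite cmat \<Rightarrow> 'n cmat set \<Rightarrow> ('n cmat \<Rightarrow> complex) \<Rightarrow> int \<Rightarrow> 'n cmat set"
  where
  "Theta W G0 \<omega> h =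
     {\<theta>. \<exists>c g. norm c = 1 \<and> g \<in> G0 \<and> \<theta> = c *\<^sub>M g \<and>
        mat_cnj \<theta> = \<theta> \<and> \<omega> g = 1 \<and> transpose \<theta> = W ** \<theta> ** matrix_inv W \<and>
        (\<forall>A\<in>G0. A ** \<theta> ** matrix_inv A = (\<omega> A powi h) *\<^sub>M \<theta>)}"

text \<open>
  Only the additive structure of the polynomial type is used (its product would be
  componentwise in the coefficients). Coefficients act from the left on powers of the argument.
\<close>

definition Fpoly ::
  "'n::finite cmat \<Rightarrow> 'n cmat set \<Rightarrow> ('n cmat \<Rightarrow> complex) \<Rightarrow> nat \<Rightarrow> int \<Rightarrow> int \<Rightarrow> 'n cmat poly set"
  where
  "Fpoly W G0 \<omega> m0 p h =
     {f. \<exists>s \<theta> (c :: nat \<Rightarrow> real). s > 0 \<and> \<theta> \<in> Theta W G0 \<omega> h \<and>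
        (\<forall>j\<in>{1..s}. c (s - j) \<noteq> 0 \<longrightarrow> even j \<and> [h + int j = p + 1] (mod int m0)) \<and>
        f = (\<Sum>j=1..s. Polynomial.monom (c (s - j) *\<^sub>R \<theta>) (j - 1))}"

definition mat_poly_eval :: "'n::finite cmat poly \<Rightarrow> 'n cmat \<Rightarrow> 'n cmat" where
  "mat_poly_eval f X = (\<Sum>i\<le>Polynomial.degree f. Polynomial.coeff f i ** mat_pow X i)"

definition Sigma0 :: "nat \<Rightarrow> (nat \<Rightarrow> nat) \<Rightarrow> (nat \<Rightarrow> nat) set" where
  "Sigma0 N m = (\<Pi>\<^sub>E a\<in>{1..N}. {0..<m a})"

text \<open>The factors are ordered: they commute only up to sign.\<close>

definition Omega_pow :: "nat \<Rightarrow> (nat \<Rightarrow> 'n::finite cmat) \<Rightarrow> (nat \<Rightarrow> nat) \<Rightarrow> 'n cmat" where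
  "Omega_pow N \<Omega> \<alpha> = foldr (\<lambda>a B. mat_pow (\<Omega> a) (\<alpha> a) ** B) [1..<Suc N] (mat 1)"

definition omega_pow ::
  "nat \<Rightarrow> (nat \<Rightarrow> 'n::finite cmat) \<Rightarrow> ('n cmat \<Rightarrow> complex) \<Rightarrow> (nat \<Rightarrow> nat) \<Rightarrow> complex" where
  "omega_pow N \<Omega> \<omega> \<alpha> = (\<Prod>a=1..N. \<omega> (\<Omega> a) ^ \<alpha> a)"

definition Lax ::
  "'n::finite cmat \<Rightarrow> nat \<Rightarrow> (nat \<Rightarrow> 'n cmat) \<Rightarrow> (nat \<Rightarrow> nat) \<Rightarrow> ('n cmat \<Rightarrow> complex) \<Rightarrow>
   nat \<Rightarrow> (nat \<Rightarrow> real) \<Rightarrow> real \<Rightarrow> 'n cmat \<Rightarrow> (nat \<Rightarrow> complex^'n) \<Rightarrow> complex \<Rightarrow> 'n cmat" where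
  "Lax W N \<Omega> m \<omega> r lam \<kappa> K \<Phi> z =
     K + \<kappa> *\<^sub>R (\<Sum>\<alpha>\<in>Sigma0 N m. \<Sum>\<sigma>=1..r.
       (1 / (z - omega_pow N \<Omega> \<omega> \<alpha> * complex_of_real (lam \<sigma>))) *\<^sub>M
         (Omega_pow N \<Omega> \<alpha> ** outer (\<Phi> \<sigma>) (\<Phi> \<sigma>) ** transpose (Omega_pow N \<Omega> \<alpha>) ** W))"

definition Lax_poles ::
  "nat \<Rightarrow> (nat \<Rightarrow> 'n::finite cmat) \<Rightarrow> (nat \<Rightarrow> nat) \<Rightarrow> ('n cmat \<Rightarrow> complex) \<Rightarrow>
   nat \<Rightarrow> (nat \<Rightarrow> real) \<Rightarrow> complex set" where
  "Lax_poles N \<Omega> m \<omega> r lam =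
     {omega_pow N \<Omega> \<omega> \<alpha> * complex_of_real (lam \<sigma>) | \<alpha> \<sigma>. \<alpha> \<in> Sigma0 N m \<and> \<sigma> \<in> {1..r}}"

text \<open>
  The coefficient of \<open>\<lambda>^k\<close> in the expansion of \<open>F(\<lambda>)\<close> at \<open>\<lambda> = \<infinity>\<close> is that of
  \<open>z^(-k)\<close> in the Laurent expansion of \<open>F(1/z)\<close> at \<open>z = 0\<close>, taken entrywise.
  A Laurent series here has only finitely many negative exponents,
  so the sum in \<open>plus_part\<close> is always finite.
\<close>

definition coeff_at_inf :: "(complex \<Rightarrow> complex^'n^'m) \<Rightarrow> int \<Rightarrow> complex^'n^'m" where
  "coeff_at_inf F k = (\<chi> i j. fls_nth (laurent_expansion (\<lambda>z. F (1 / z) $ i $ j) 0) (- k))"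

definition plus_part :: "(complex \<Rightarrow> 'n::finite cmat) \<Rightarrow> complex \<Rightarrow> 'n cmat" where
  "plus_part F z =
     (\<Sum>k | coeff_at_inf F (int k) \<noteq> 0. z ^ k *\<^sub>M coeff_at_inf F (int k))"

text \<open>The polynomial with the coefficient sequence \<open>V\<close>, leading coefficient first.\<close>

definition lam_poly :: "nat \<Rightarrow> (nat \<Rightarrow> 'n::finite cmat) \<Rightarrow> complex \<Rightarrow> 'n cmat" where
  "lam_poly p V z = (\<Sum>j=0..p. z ^ (p - j) *\<^sub>M V j)"

end

theory Submission
  imports Defs
begin

text \<open>
  Conjugation by \<open>A \<in> G0\<close> permutes the poles of \<open>L\<close> (elements of \<open>G0\<close> commute up to sign, and signs
  cancel in the residues), so \<open>A L(\<lambda>) A\<inverse> = \<omega>(A) L(\<omega>(A) \<lambda>)\<close>; likewise \<open>cnj L(\<lambda>) = L(cnj \<lambda>)\<close>.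
  Hence \<open>\<theta>\<close> commutes with \<open>L\<close>, and the coefficients of \<open>f(L)\<close> at infinity inherit the
  symmetries defining the spaces \<open>D\<^sub>k\<close>.

  The flow of the \<open>\<Phi>\<^sub>\<sigma>\<close> moves the residue \<open>P\<close> at \<open>\<mu>\<close> by \<open>[U(\<mu>), P]\<close>. So \<open>[U, L] - L\<^sub>x\<close> has no poles:
  it extends to an entire function, because \<open>U(\<lambda>) - U(\<mu>)\<close> is divisible by \<open>\<lambda> - \<mu>\<close>. Under the constraint,
  \<open>U - \<lambda>\<^sup>p f(L)\<close> tends to \<open>0\<close> at infinity and \<open>f(L)\<close> commutes with \<open>L\<close>, so this entire function
  tends to \<open>0\<close> at infinity and vanishes by Liouville's theorem.
\<close>

section \<open>Complex matrices\<close>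

lemma mat_scale_nth [simp]: "(c *\<^sub>M A) $ i $ j = c * A $ i $ j"
  by (simp add: mat_scale_def)

lemma mat_scale_mult_left [simp]: "(c *\<^sub>M A) ** B = c *\<^sub>M (A ** B)"
  by (simp add: vec_eq_iff matrix_matrix_mult_def sum_distrib_left mult_ac)

lemma mat_scale_mult_right [simp]: "A ** (c *\<^sub>M B) = c *\<^sub>M (A ** B)"
  by (simp add: vec_eq_iff matrix_matrix_mult_def sum_distrib_left mult_ac)

lemma mat_scale_mat_scale [simp]: "c *\<^sub>M d *\<^sub>M A = (c * d) *\<^sub>M A"
  by (simp add: vec_eq_iff)

lemma mat_scale_one [simp]: "1 *\<^sub>M A = A"
  by (simp add: vec_eq_iff)

lemma mat_scale_zero [simp]: "c *\<^sub>M 0 = 0"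
  by (simp add: vec_eq_iff)

lemma mat_scale_minus: "c *\<^sub>M (- A) = - (c *\<^sub>M A)"
  by (simp add: vec_eq_iff)

lemma mat_scale_minus_left [simp]: "(- c) *\<^sub>M A = - (c *\<^sub>M A)"
  by (simp add: vec_eq_iff)

lemma scaleR_eq_mat_scale: "r *\<^sub>R A = complex_of_real r *\<^sub>M A"
  by (simp add: vec_eq_iff scaleR_conv_of_real[where 'a = complex])

lemma bounded_linear_mat_scale: "bounded_linear (\<lambda>A. c *\<^sub>M A)"
  by (rule linear_conv_bounded_linear[THEN iffD1], rule linearI)
     (simp_all add: vec_eq_iff algebra_simps)

lemma bounded_bilinear_matrix_mult:
  "bounded_bilinear ((**) :: complex^'n^'m \<Rightarrow> complex^'k^'n \<Rightarrow> complex^'k^'m)"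
  unfolding bilinear_conv_bounded_bilinear[symmetric] bilinear_def
  by (intro conjI allI linearI)
     (simp_all add: vec_eq_iff matrix_matrix_mult_def sum.distrib distrib_left distrib_right
        scaleR_right.sum)

text \<open>Supplies distributivity over sums, sign rules and limits for \<open>**\<close>, which is
  not the product of the type class.\<close>

interpretation matmul: bounded_bilinear "(**) :: complex^'n^'m \<Rightarrow> complex^'k^'n \<Rightarrow> complex^'k^'m"
  by (rule bounded_bilinear_matrix_mult)

lemma bounded_linear_transpose: "bounded_linear (transpose :: complex^'n^'m \<Rightarrow> complex^'m^'n)"
  by (rule linear_conv_bounded_linear[THEN iffD1], rule linearI)
     (simp_all add: vec_eq_iff transpose_def)

lemma bounded_linear_mat_cnj: "bounded_linear (mat_cnj :: complex^'n^'m \<Rightarrow> complex^'n^'m)"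
  by (rule linear_conv_bounded_linear[THEN iffD1], rule linearI)
     (simp_all add: vec_eq_iff)

lemmas mscale_linear = bounded_linear.linear[OF bounded_linear_mat_scale]
lemmas transpose_linear = bounded_linear.linear[OF bounded_linear_transpose]
lemmas mat_cnj_linear = bounded_linear.linear[OF bounded_linear_mat_cnj]

text \<open>Gives the product rule when the numerators of the Lax matrix are differentiated in
  x.\<close>

lemma bounded_bilinear_outer: "bounded_bilinear outer"
  unfolding bilinear_conv_bounded_bilinear[symmetric] bilinear_def
  by (intro conjI allI linearI)
     (simp_all add: vec_eq_iff outer_def distrib_left distrib_right)

lemma mat_cnj_mult: "mat_cnj (A ** B) = mat_cnj A ** mat_cnj B"
  by (simp add: vec_eq_iff matrix_matrix_mult_def)

lemma mat_cnj_scale [simp]: "mat_cnj (c *\<^sub>M A) = cnj c *\<^sub>M mat_cnj A"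
  by (simp add: vec_eq_iff)

lemma mat_cnj_transpose: "mat_cnj (transpose A) = transpose (mat_cnj A)"
  by (simp add: vec_eq_iff transpose_def)

lemma mat_cnj_one [simp]: "mat_cnj (mat 1) = mat 1"
  by (simp add: vec_eq_iff mat_def)

lemma mat_cnj_pow: "mat_cnj (mat_pow A k) = mat_pow (mat_cnj A) k"
  by (induction k) (simp_all add: mat_cnj_mult)

lemma transpose_scale [simp]: "transpose (c *\<^sub>M A) = c *\<^sub>M transpose A"
  by (simp add: vec_eq_iff transpose_def)

lemma outer_mult_left: "outer (A *v v) w = A ** outer v w"
  by (simp add: vec_eq_iff outer_def matrix_matrix_mult_def matrix_vector_mult_def
      sum_distrib_left mult_ac)

lemma outer_mult_right: "outer v (A *v w) = outer v w ** transpose A"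
  by (simp add: vec_eq_iff outer_def matrix_matrix_mult_def matrix_vector_mult_def
      transpose_def sum_distrib_left mult_ac)

lemma transpose_outer: "transpose (outer v w) = outer w v"
  by (simp add: vec_eq_iff outer_def transpose_def)

section \<open>Matrix powers and inverses\<close>

lemma mat_pow_add: "mat_pow A (k + l) = mat_pow A k ** mat_pow A l"
  by (induction k) (simp_all add: matrix_mul_assoc)

lemma mat_pow_commute: "A ** B = B ** A \<Longrightarrow> A ** mat_pow B k = mat_pow B k ** A"
proof (induction k)
  case (Suc k)
  then show ?case by simp (metis matrix_mul_assoc)
qed simp

lemma mat_pow_Suc_right: "mat_pow A (Suc k) = mat_pow A k ** A"
  using mat_pow_commute[of A A k] by simp

lemma matrix_inv_mult [simp]:
  fixes A :: "complex^'n^'n"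
  assumes "invertible A"
  shows "A ** matrix_inv A = mat 1" "matrix_inv A ** A = mat 1"
  using someI_ex[OF assms[unfolded invertible_def]] unfolding matrix_inv_def by auto

lemma matrix_inv_cancel [simp]:
  fixes A :: "complex^'n^'n"
  assumes "invertible A"
  shows "B ** A ** matrix_inv A = B" "B ** matrix_inv A ** A = B"
  using assms by (simp_all flip: matrix_mul_assoc)

text \<open>A right inverse of a square matrix is two-sided, so a single product pins down the
  chosen inverse.\<close>

lemma matrix_inv_unique:
  fixes A B :: "complex^'n^'n"
  assumes "A ** B = mat 1"
  shows "matrix_inv A = B"
proof -
  have "invertible A"
    using assms by (auto simp: invertible_right_inverse)
  then show ?thesis
    by (metis assms matrix_inv_mult(2) matrix_mul_assoc matrix_mul_lid matrix_mul_rid)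
qed

lemma conj_mat_pow:
  fixes A :: "complex^'n^'n"
  assumes "invertible A"
  shows "A ** mat_pow X k ** matrix_inv A = mat_pow (A ** X ** matrix_inv A) k"
proof (induction k)
  case (Suc k)
  have "A ** (X ** mat_pow X k) ** matrix_inv A
    = (A ** X ** matrix_inv A) ** (A ** mat_pow X k ** matrix_inv A)"
    using assms by (simp add: matrix_mul_assoc)
  with Suc show ?case by simp
qed (use assms in simp)

lemma mat_pow_scale: "mat_pow (c *\<^sub>M X) k = c ^ k *\<^sub>M mat_pow X k"
  by (induction k) (simp_all add: mult_ac)

text \<open>Equality modulo {I, -I}, kept at the level of matrices rather than cosets. Elements of
  G0 commute only in this sense, while conjugation, the numerators of the Lax matrix and \<omega> on
  G0 do not see the sign.\<close>

definition pm_eq :: "'n::finite cmat \<Rightarrow> 'n cmat \<Rightarrow> bool" (infix \<open>\<doteq>\<close> 50) where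
  "A \<doteq> B \<longleftrightarrow> A = B \<or> A = - B"

lemma pm_eq_refl [simp]: "A \<doteq> A"
  by (simp add: pm_eq_def)

lemma pm_eq_sym: "A \<doteq> B \<Longrightarrow> B \<doteq> A"
  by (auto simp: pm_eq_def)

lemma pm_eq_trans [trans]: "A \<doteq> B \<Longrightarrow> B \<doteq> C \<Longrightarrow> A \<doteq> C"
  by (auto simp: pm_eq_def)

lemma pm_eq_mult: "A \<doteq> B \<Longrightarrow> C \<doteq> D \<Longrightarrow> A ** C \<doteq> B ** D"
  by (auto simp: pm_eq_def matmul.minus_left matmul.minus_right)

lemma pm_eq_mult_cancel:
  fixes A B C :: "'n::finite cmat"
  assumes "invertible C" "A ** C \<doteq> B ** C"
  shows "A \<doteq> B"
  using pm_eq_mult[OF assms(2) pm_eq_refl[of "matrix_inv C"]] assms(1) by simp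

lemma matrix_inv_minus:
  fixes A :: "complex^'n^'n"
  assumes "invertible A"
  shows "matrix_inv (- A) = - matrix_inv A"
  using assms by (intro matrix_inv_unique) (simp add: matmul.minus_left matmul.minus_right)

lemma pm_eq_inv: "A \<doteq> B \<Longrightarrow> invertible A \<Longrightarrow> matrix_inv A \<doteq> matrix_inv B"
  by (metis pm_eq_def minus_minus matrix_inv_minus)

lemma pm_eq_conj:
  fixes A B :: "'n::finite cmat"
  assumes "A \<doteq> B" "invertible A"
  shows "A ** X ** matrix_inv A = B ** X ** matrix_inv B"
proof (cases "A = B")
  case False
  then have "B = - A" using assms by (auto simp: pm_eq_def)
  then show ?thesis using matrix_inv_minus[OF assms(2)]
    by (simp add: matmul.minus_left matmul.minus_right)
qed simp

section \<open>The symplectic group and its finite subgroup\<close>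

text \<open>The numerator of one term of the Lax matrix, with A in place of \<Omega>^\<alpha>. It is
  quadratic in A, hence insensitive to the sign of A.\<close>

definition rank_one :: "'n::finite cmat \<Rightarrow> complex^'n \<Rightarrow> 'n cmat \<Rightarrow> 'n cmat" where
  "rank_one W v A = A ** outer v v ** transpose A ** W"

lemma rank_one_pm_eq: "A \<doteq> B \<Longrightarrow> rank_one W v A = rank_one W v B"
  by (auto simp: pm_eq_def rank_one_def matmul.minus_left matmul.minus_right linear_neg[OF transpose_linear])

locale reduction_group =
  fixes W :: "'n::finite cmat" and G0 :: "'n cmat set" and \<omega> :: "'n cmat \<Rightarrow> complex"
  assumes W_real: "mat_cnj W = W"
    and W_inv: "invertible W"
    and W_antisym: "transpose W = - W"
    and G0_subgroup: "subgroup G0 (symp_group W)"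
    and G0_cnj: "\<And>A. A \<in> G0 \<Longrightarrow> mat_cnj A ** A = mat 1 \<or> mat_cnj A ** A = - mat 1"
    and omega_hom: "\<omega> \<in> hom ((symp_group W)\<lparr>carrier := G0\<rparr>) circle_group"
    and omega_pmI: "\<And>A. A \<in> G0 \<inter> pmI \<Longrightarrow> \<omega> A = 1"
begin

text \<open>Clearing the inverse of W leaves an equation between two linear images of X, which can
  be compared coefficient by coefficient in an expansion.\<close>

lemma symp_alg_iff: "X \<in> symp_alg W \<longleftrightarrow> transpose X ** W = - (W ** X)"
proof -
  have "transpose X = - (W ** X ** matrix_inv W) \<longleftrightarrow> transpose X ** W = - (W ** X)"
    using W_inv matrix_inv_cancel
    by (metis matmul.minus_left)
  then show ?thesis by (simp add: symp_alg_def)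
qed

lemma group_symp_group: "group (symp_group W)"
proof (rule groupI)
  fix A assume A: "A \<in> carrier (symp_group W)"
  let ?B = "matrix_inv A"
  from A have inv: "invertible A" and AW: "transpose A ** W ** A = W"
    by (auto simp: symp_group_def)
  have "invertible ?B" using matrix_inv_mult[OF inv] unfolding invertible_def by blast
  moreover have "transpose ?B ** W ** ?B = W"
  proof -
    have "transpose ?B ** transpose A = mat 1"
      using inv by (simp flip: matrix_transpose_mul)
    then have "transpose ?B ** (transpose A ** W ** A) ** ?B = W"
      using inv by (simp add: matrix_mul_assoc)
    then show ?thesis by (simp add: AW)
  qed
  ultimately show "\<exists>B\<in>carrier (symp_group W). B \<otimes>\<^bsub>symp_group W\<^esub> A = \<one>\<^bsub>symp_group W\<^esub>"
    using inv by (auto simp: symp_group_def intro!: bexI[of _ ?B])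
next
  fix A B assume "A \<in> carrier (symp_group W)" "B \<in> carrier (symp_group W)"
  then have A: "invertible A" "transpose A ** W ** A = W" and B: "invertible B" "transpose B ** W ** B = W"
    by (auto simp: symp_group_def)
  have "transpose (A ** B) ** W ** (A ** B) = transpose B ** (transpose A ** W ** A) ** B"
    by (simp add: matrix_transpose_mul matrix_mul_assoc)
  then show "A \<otimes>\<^bsub>symp_group W\<^esub> B \<in> carrier (symp_group W)"
    using A B by (simp add: symp_group_def invertible_mult)
next
  have "invertible (mat 1 :: 'n cmat)"
    unfolding invertible_def by (rule exI[of _ "mat 1"]) simp
  then show "\<one>\<^bsub>symp_group W\<^esub> \<in> carrier (symp_group W)"
    by (simp add: symp_group_def)
qed (simp_all add: symp_group_def matrix_mul_assoc)

sublocale symp: group "symp_group W"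
  by (rule group_symp_group)

lemma symp_group_simps [simp]:
  "mult (symp_group W) = (**)" "one (symp_group W) = mat 1"
  by (simp_all add: symp_group_def)

section \<open>Arithmetic in G0 and of the character \<omega>\<close>

lemma G0D:
  assumes "A \<in> G0"
  shows "invertible A" "transpose A ** W ** A = W" "A \<in> carrier (symp_group W)"
  using assms subgroup.subset[OF G0_subgroup] by (auto simp: symp_group_def)

lemma symp_inv_eq:
  assumes "A \<in> carrier (symp_group W)" 
  shows "inv\<^bsub>symp_group W\<^esub> A = matrix_inv A"
  using symp.r_inv[OF assms] by (intro matrix_inv_unique[symmetric]) simp

lemma G0_one: "mat 1 \<in> G0"
  using subgroup.one_closed[OF G0_subgroup] by simp

lemma G0_mult: "A \<in> G0 \<Longrightarrow> B \<in> G0 \<Longrightarrow> A ** B \<in> G0"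
  using subgroup.m_closed[OF G0_subgroup] by simp

lemma G0_inv: "A \<in> G0 \<Longrightarrow> matrix_inv A \<in> G0"
  using subgroup.m_inv_closed[OF G0_subgroup] by (simp add: symp_inv_eq G0D)

lemma G0_pow: "A \<in> G0 \<Longrightarrow> mat_pow A k \<in> G0"
  by (induction k) (auto intro: G0_one G0_mult)

lemma omega_mult: "A \<in> G0 \<Longrightarrow> B \<in> G0 \<Longrightarrow> \<omega> (A ** B) = \<omega> A * \<omega> B"
  using omega_hom by (auto simp: hom_def circle_group_def)

lemma omega_norm: "A \<in> G0 \<Longrightarrow> norm (\<omega> A) = 1"
  using omega_hom by (auto simp: hom_def circle_group_def)

lemma omega_nz: "A \<in> G0 \<Longrightarrow> \<omega> A \<noteq> 0"
  using omega_norm by fastforce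

lemma omega_one: "\<omega> (mat 1) = 1"
  by (rule omega_pmI) (auto simp: pmI_def G0_one)

lemma omega_inv: "A \<in> G0 \<Longrightarrow> \<omega> (matrix_inv A) = inverse (\<omega> A)"
  using omega_mult[of A "matrix_inv A"] omega_nz[of A]
  by (simp add: G0_inv G0D(1) omega_one nonzero_imp_inverse_nonzero inverse_unique)

lemma omega_pow: "A \<in> G0 \<Longrightarrow> \<omega> (mat_pow A k) = \<omega> A ^ k"
  by (induction k) (simp_all add: omega_one omega_mult G0_pow)

text \<open>For opposite signs, \<open>A ** matrix_inv B\<close> is -I, an element of G0 on which
  \<omega> is 1.\<close>

lemma omega_pm_eq:
  assumes "A \<in> G0" "B \<in> G0" "A \<doteq> B"
  shows "\<omega> A = \<omega> B"
proof (cases "A = B")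
  case False
  then have "A = - B" using assms by (auto simp: pm_eq_def)
  then have "A ** matrix_inv B = - mat 1" using G0D(1)[OF assms(2)] by (simp add: matmul.minus_left)
  then have "A ** matrix_inv B \<in> G0 \<inter> pmI"
    using G0_mult[OF assms(1) G0_inv[OF assms(2)]] by (simp add: pmI_def)
  then have "\<omega> (A ** matrix_inv B) = 1" by (rule omega_pmI)
  then show ?thesis using assms by (simp add: omega_mult G0_inv omega_inv omega_nz field_simps)
qed simp

text \<open>Cancel A in the hypothesis on \<open>mat_cnj A ** A\<close>. On G0 conjugation is thus
  inversion up to sign, which forces commutativity up to sign and determines how conjugation
  permutes the poles.\<close>

lemma cnj_pm_eq_inv:
  assumes "A \<in> G0" shows "mat_cnj A \<doteq> matrix_inv A"
proof (rule pm_eq_mult_cancel[OF G0D(1)[OF assms]])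
  show "mat_cnj A ** A \<doteq> matrix_inv A ** A"
    using G0_cnj[OF assms] G0D(1)[OF assms] by (auto simp: pm_eq_def)
qed

lemma inv_mult:
  assumes "A \<in> G0" "B \<in> G0"
  shows "matrix_inv (A ** B) = matrix_inv B ** matrix_inv A"
  using assms G0D(1) by (intro matrix_inv_unique) (simp add: matrix_mul_assoc)

text \<open>Conjugation is multiplicative and inversion anti-multiplicative. As they agree up to
  sign on G0, the inverses of A B and B A agree up to sign.\<close>

lemma G0_commute:
  assumes "A \<in> G0" "B \<in> G0"
  shows "A ** B \<doteq> B ** A"
proof -
  have "matrix_inv (A ** B) \<doteq> mat_cnj (A ** B)"
    using assms by (intro pm_eq_sym[OF cnj_pm_eq_inv] G0_mult)
  also have "mat_cnj (A ** B) \<doteq> matrix_inv A ** matrix_inv B"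
    unfolding mat_cnj_mult using assms by (intro pm_eq_mult cnj_pm_eq_inv)
  also have "matrix_inv A ** matrix_inv B = matrix_inv (B ** A)"
    using assms by (simp add: inv_mult)
  finally have *: "matrix_inv (A ** B) \<doteq> matrix_inv (B ** A)" .
  have inv_inv: "matrix_inv (matrix_inv C) = C" if "C \<in> G0" for C
    using G0D(1)[OF that] by (intro matrix_inv_unique) simp
  have "invertible (matrix_inv (A ** B))"
    using assms by (intro G0D(1) G0_inv G0_mult)
  from pm_eq_inv[OF * this] show ?thesis
    using assms by (simp add: inv_inv G0_mult)
qed

lemma W_mult_inv:
  assumes "A \<in> G0"
  shows "W ** matrix_inv A = transpose A ** W"
proof -
  have "W ** matrix_inv A = transpose A ** W ** A ** matrix_inv A"
    by (simp add: G0D(2)[OF assms])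
  then show ?thesis using G0D(1)[OF assms] by simp
qed

text \<open>The symplectic relation carries the inverse of A across W and turns it into the
  transpose of A, so conjugation merely multiplies the index matrix from the left.\<close>

lemma conj_rank_one:
  assumes "A \<in> G0"
  shows "A ** rank_one W v B ** matrix_inv A = rank_one W v (A ** B)"
proof -
  have "A ** rank_one W v B ** matrix_inv A
    = A ** (B ** outer v v ** transpose B) ** (W ** matrix_inv A)"
    by (simp add: rank_one_def matrix_mul_assoc)
  then show ?thesis
    unfolding W_mult_inv[OF assms] by (simp add: rank_one_def matrix_mul_assoc matrix_transpose_mul)
qed

text \<open>\<open>outer v v\<close> is symmetric and W antisymmetric, so transposition produces
  exactly one sign.\<close>

lemma rank_one_symp_alg: "rank_one W v A \<in> symp_alg W"
  by (simp add: symp_alg_iff rank_one_def matrix_transpose_mul transpose_outer W_antisym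
      matmul.minus_left matrix_mul_assoc)

lemma cnj_rank_one:
  fixes v :: "complex^'n"
  assumes "\<And>i. v $ i \<in> \<real>"
  shows "mat_cnj (rank_one W v A) = rank_one W v (mat_cnj A)"
proof -
  have "mat_cnj (outer v v) = outer v v"
    using assms by (simp add: vec_eq_iff outer_def Reals_cnj_iff)
  then show ?thesis
    by (simp add: rank_one_def mat_cnj_mult mat_cnj_transpose W_real)
qed

end

section \<open>Generators and the index set of the poles\<close>

locale reduction_generators = reduction_group W G0 \<omega>
  for W :: "'n::finite cmat" and G0 \<omega> +
  fixes \<Omega> :: "nat \<Rightarrow> 'n cmat" and N :: nat and m :: "nat \<Rightarrow> nat"
  assumes Omega_in: "\<And>a. a \<in> {1..N} \<Longrightarrow> \<Omega> a \<in> G0"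
    and Omega_gen: "generate (proj_group W) (pr W ` \<Omega> ` {1..N}) = pr W ` G0"
    and m_ord: "\<And>a. a \<in> {1..N} \<Longrightarrow> m a = group.ord (proj_group W) (pr W (\<Omega> a))"
begin

text \<open>Both elements are central. This makes \<open>proj_group W\<close> a group and
  \<open>pr W\<close> a homomorphism.\<close>

lemma normal_pmI: "normal pmI (symp_group W)"
proof (rule symp.normal_invI)
  have "matrix_inv (- mat 1 :: 'n cmat) = - mat 1"
    by (intro matrix_inv_unique) (simp add: matmul.minus_left)
  moreover have "matrix_inv (mat 1 :: 'n cmat) = mat 1"
    by (intro matrix_inv_unique) simp
  moreover have pmI: "pmI \<subseteq> carrier (symp_group W)"
    by (auto simp: pmI_def symp_group_def matmul.minus_left matmul.minus_right
        linear_neg[OF transpose_linear] invertible_def intro: exI[of _ "mat 1"] exI[of _ "- mat 1"])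
  ultimately show "subgroup pmI (symp_group W)"
    by (intro symp.subgroupI)
       (auto simp: symp_inv_eq subset_iff, auto simp: pmI_def matmul.minus_left)
next
  fix A B :: "'n cmat"
  assume "A \<in> carrier (symp_group W)" "B \<in> pmI"
  then show "A \<otimes>\<^bsub>symp_group W\<^esub> B \<otimes>\<^bsub>symp_group W\<^esub> inv\<^bsub>symp_group W\<^esub> A \<in> pmI"
    using symp_inv_eq[of A] symp.r_inv[of A] by (auto simp: pmI_def matmul.minus_left matmul.minus_right)
qed

sublocale proj: group_hom "symp_group W" "proj_group W" "pr W"
proof -
  have "pr W = (\<lambda>A. pmI #>\<^bsub>symp_group W\<^esub> A)" by (simp add: fun_eq_iff pr_def)
  then show "group_hom (symp_group W) (proj_group W) (pr W)"
    using normal.r_coset_hom_Mod[OF normal_pmI] normal.factorgroup_is_group[OF normal_pmI]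
      group_symp_group
    by (simp add: group_hom_def group_hom_axioms_def proj_group_def)
qed

lemma pr_eqD: "pr W A = pr W B \<Longrightarrow> A \<doteq> B"
  by (auto simp: pr_def r_coset_def pmI_def pm_eq_def matmul.minus_left doubleton_eq_iff)

lemma symp_pow: "A \<in> G0 \<Longrightarrow> A [^]\<^bsub>symp_group W\<^esub> k = mat_pow A k"
  by (induction k) (simp_all add: mat_pow_Suc_right del: mat_pow.simps(2))

lemma pow_m:
  assumes "a \<in> {1..N}"
  shows "mat_pow (\<Omega> a) (m a) \<doteq> mat 1"
proof -
  note a = G0D(3)[OF Omega_in[OF assms]]
  have "pr W (mat_pow (\<Omega> a) (m a)) = pr W (\<Omega> a) [^]\<^bsub>proj_group W\<^esub> m a"
    using proj.hom_nat_pow[OF a] symp_pow[OF Omega_in[OF assms]] by simp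
  also have "\<dots> = pr W (mat 1)"
    using proj.H.pow_ord_eq_1[OF proj.hom_closed[OF a]] proj.hom_one m_ord[OF assms] by simp
  finally show ?thesis by (rule pr_eqD)
qed

text \<open>The generators generate only after projection, so an element of G0 is a word in them
  only up to sign; hence the case \<open>pm_eq\<close>. The induction runs in the quotient and
  carries along a representative in G0 that satisfies P.\<close>

lemma generator_induct [consumes 1, case_names one generator inv mult pm_eq]:
  assumes "A \<in> G0"
    and one: "P (mat 1)"
    and gen: "\<And>a. a \<in> {1..N} \<Longrightarrow> P (\<Omega> a)"
    and inv: "\<And>A. A \<in> G0 \<Longrightarrow> P A \<Longrightarrow> P (matrix_inv A)"
    and mult: "\<And>A B. A \<in> G0 \<Longrightarrow> B \<in> G0 \<Longrightarrow> P A \<Longrightarrow> P B \<Longrightarrow> P (A ** B)"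
    and pm: "\<And>A B. A \<in> G0 \<Longrightarrow> B \<in> G0 \<Longrightarrow> A \<doteq> B \<Longrightarrow> P A \<Longrightarrow> P B"
  shows "P A"
proof -
  have "\<exists>B\<in>G0. X = pr W B \<and> P B"
    if "X \<in> generate (proj_group W) (pr W ` \<Omega> ` {1..N})" for X
    using that
  proof induction
    case one
    then show ?case using assms(2) G0_one proj.hom_one by (intro bexI[of _ "mat 1"]) auto
  next
    case (incl X)
    then show ?case using gen Omega_in by auto
  next
    case (inv X)
    then obtain a where a: "a \<in> {1..N}" "X = pr W (\<Omega> a)" by auto
    have "inv\<^bsub>proj_group W\<^esub> X = pr W (matrix_inv (\<Omega> a))"
      using a Omega_in[OF a(1)] by (simp add: G0D(3) flip: symp_inv_eq)
    then show ?case using a assms(4) gen Omega_in G0_inv by blast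
  next
    case (eng X Y)
    then obtain B C where "B \<in> G0" "X = pr W B" "P B" "C \<in> G0" "Y = pr W C" "P C" by blast
    moreover from this have "X \<otimes>\<^bsub>proj_group W\<^esub> Y = pr W (B ** C)"
      using proj.hom_mult[of B C] by (simp add: G0D(3))
    ultimately show ?case using mult G0_mult by blast
  qed
  then obtain B where "B \<in> G0" "pr W A = pr W B" "P B"
    using assms(1) Omega_gen by blast
  then show ?thesis using pm assms(1) pr_eqD pm_eq_sym by blast
qed

text \<open>On a generator, \<omega> raised to the order m a is the value of \<omega> at I or -I,
  namely 1, and m a divides the least common multiple. The property passes to products, inverses and
  sign changes.\<close>

lemma omega_pow_Lcm:
  assumes "A \<in> G0"
  shows "\<omega> A ^ Lcm (m ` {1..N}) = 1"
  using assms
proof (induction rule: generator_induct)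
  case (generator a)
  have "\<omega> (\<Omega> a) ^ m a = 1"
    using omega_pm_eq[OF _ _ pow_m[OF generator]] Omega_in[OF generator]
    by (simp add: G0_pow G0_one omega_pow omega_one)
  moreover have "m a dvd Lcm (m ` {1..N})" using generator by (intro dvd_Lcm) auto
  ultimately show ?case by (metis dvdE power_mult power_one)
qed (auto simp: omega_one omega_inv omega_mult power_inverse power_mult_distrib dest: omega_pm_eq)

lemma omega_powi_cong:
  assumes "A \<in> G0" "[k = l] (mod int (Lcm (m ` {1..N})))"
  shows "\<omega> A powi k = \<omega> A powi l"
proof -
  obtain q where "k = l + int (Lcm (m ` {1..N})) * q"
    using assms(2) by (metis cong_iff_lin cong_sym)
  then show ?thesis
    using assms(1) omega_pow_Lcm[OF assms(1)]
    by (simp add: power_int_add omega_nz power_int_mult)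
qed

text \<open>Generalizes \<open>Omega_pow\<close> to an arbitrary list of indices, so that the
  ordered product can be treated by induction on the list.\<close>

definition list_pow :: "nat list \<Rightarrow> (nat \<Rightarrow> nat) \<Rightarrow> 'n cmat" where
  "list_pow xs \<alpha> = foldr (\<lambda>a B. mat_pow (\<Omega> a) (\<alpha> a) ** B) xs (mat 1)"

lemma list_pow_simps [simp]:
  "list_pow [] \<alpha> = mat 1"
  "list_pow (a # xs) \<alpha> = mat_pow (\<Omega> a) (\<alpha> a) ** list_pow xs \<alpha>"
  by (simp_all add: list_pow_def)

lemma list_pow_in_G0: "set xs \<subseteq> {1..N} \<Longrightarrow> list_pow xs \<alpha> \<in> G0"
  by (induction xs) (auto intro!: G0_one G0_mult G0_pow Omega_in)

text \<open>Collecting the two powers of each generator requires moving one of them past the other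
  product, and G0 allows this only up to sign.\<close>

lemma list_pow_add:
  "set xs \<subseteq> {1..N} \<Longrightarrow> list_pow xs (\<lambda>a. \<alpha> a + \<beta> a) \<doteq> list_pow xs \<alpha> ** list_pow xs \<beta>"
proof (induction xs)
  case (Cons a xs)
  let ?A = "mat_pow (\<Omega> a) (\<alpha> a)" and ?B = "mat_pow (\<Omega> a) (\<beta> a)"
  have "list_pow (a # xs) (\<lambda>a. \<alpha> a + \<beta> a) \<doteq> (?A ** ?B) ** (list_pow xs \<alpha> ** list_pow xs \<beta>)"
    using Cons by (simp add: mat_pow_add pm_eq_mult)
  also have "\<dots> = ?A ** (?B ** list_pow xs \<alpha>) ** list_pow xs \<beta>"
    by (simp add: matrix_mul_assoc)
  also have "\<dots> \<doteq> ?A ** (list_pow xs \<alpha> ** ?B) ** list_pow xs \<beta>"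
    using Cons.prems
    by (intro pm_eq_mult pm_eq_refl G0_commute G0_pow Omega_in list_pow_in_G0) auto
  finally show ?case by (simp add: matrix_mul_assoc)
qed simp

lemma mat_pow_mod:
  assumes "a \<in> {1..N}"
  shows "mat_pow (\<Omega> a) k \<doteq> mat_pow (\<Omega> a) (k mod m a)"
proof -
  have "mat_pow (\<Omega> a) (m a * q) \<doteq> mat 1" for q
  proof (induction q)
    case (Suc q)
    then show ?case using pm_eq_mult[OF pow_m[OF assms] Suc] by (simp add: mat_pow_add)
  qed simp
  from pm_eq_mult[OF this pm_eq_refl, of "k div m a" "mat_pow (\<Omega> a) (k mod m a)"]
  show ?thesis by (simp flip: mat_pow_add)
qed

lemma list_pow_mod:
  assumes "set xs \<subseteq> {1..N}" "\<And>a. a \<in> set xs \<Longrightarrow> \<alpha> a mod m a = \<beta> a mod m a"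
  shows "list_pow xs \<alpha> \<doteq> list_pow xs \<beta>"
  using assms
proof (induction xs)
  case (Cons a xs)
  then have "mat_pow (\<Omega> a) (\<alpha> a) \<doteq> mat_pow (\<Omega> a) (\<beta> a)"
    using mat_pow_mod[of a "\<alpha> a"] mat_pow_mod[of a "\<beta> a"]
    by (auto intro: pm_eq_trans pm_eq_sym)
  then show ?case using Cons by (auto intro!: pm_eq_mult)
qed simp

lemma list_pow_zero: "list_pow xs (\<lambda>_. 0) = mat 1"
  by (induction xs) simp_all

lemma list_pow_unit:
  "distinct xs \<Longrightarrow> list_pow xs (\<lambda>b. if b = a then 1 else 0) = (if a \<in> set xs then \<Omega> a else mat 1)"
  by (induction xs) auto

lemma omega_list_pow:
  "set xs \<subseteq> {1..N} \<Longrightarrow> \<omega> (list_pow xs \<alpha>) = (\<Prod>a\<leftarrow>xs. \<omega> (\<Omega> a) ^ \<alpha> a)"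
  by (induction xs) (simp_all add: omega_one omega_mult omega_pow G0_pow Omega_in list_pow_in_G0)

section \<open>The elements \<Omega>^\<alpha> and reindexing of sums over exponents\<close>

lemma Omega_pow_eq: "Omega_pow N \<Omega> \<alpha> = list_pow [1..<Suc N] \<alpha>"
  by (simp add: Omega_pow_def list_pow_def)

lemma upt_subset: "set [1..<Suc N] \<subseteq> {1..N}"
  by auto

lemma Omega_pow_in_G0: "Omega_pow N \<Omega> \<alpha> \<in> G0"
  unfolding Omega_pow_eq by (rule list_pow_in_G0[OF upt_subset])

text \<open>Position and numerator of a term of the Lax matrix become functions of one matrix
  \<Omega>^\<alpha>, to which the reindexing of sums over \<alpha> applies.\<close>

lemma omega_pow_eq: "omega_pow N \<Omega> \<omega> \<alpha> = \<omega> (Omega_pow N \<Omega> \<alpha>)"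
  unfolding Omega_pow_eq omega_list_pow[OF upt_subset] omega_pow_def
  by (simp add: prod.distinct_set_conv_list[symmetric] atLeastLessThanSuc_atLeastAtMost del: upt_Suc)

lemma Omega_pow_unit_add:
  assumes "a \<in> {1..N}"
    and "\<And>b. b \<in> {1..N} \<Longrightarrow> \<beta> b mod m b = (\<alpha> b + (if b = a then 1 else 0)) mod m b"
  shows "Omega_pow N \<Omega> \<beta> \<doteq> \<Omega> a ** Omega_pow N \<Omega> \<alpha>"
proof -
  let ?e = "\<lambda>b. if b = a then 1 else 0 :: nat"
  have "Omega_pow N \<Omega> \<beta> \<doteq> list_pow [1..<Suc N] (\<lambda>b. ?e b + \<alpha> b)"
    unfolding Omega_pow_eq using assms(2) by (intro list_pow_mod) (auto simp: add_ac)
  also have "\<dots> \<doteq> list_pow [1..<Suc N] ?e ** list_pow [1..<Suc N] \<alpha>"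
    by (rule list_pow_add[OF upt_subset])
  finally show ?thesis
    using assms(1) unfolding Omega_pow_eq by (subst (asm) list_pow_unit) (auto simp del: upt_Suc)
qed

lemma Omega_pow_neg:
  assumes "\<And>b. b \<in> {1..N} \<Longrightarrow> (\<beta> b + \<alpha> b) mod m b = 0"
  shows "Omega_pow N \<Omega> \<beta> \<doteq> matrix_inv (Omega_pow N \<Omega> \<alpha>)"
proof -
  let ?A = "Omega_pow N \<Omega> \<alpha>" and ?B = "Omega_pow N \<Omega> \<beta>"
  have inv: "invertible ?A" by (rule G0D(1)[OF Omega_pow_in_G0])
  have "?B ** ?A \<doteq> list_pow [1..<Suc N] (\<lambda>b. \<beta> b + \<alpha> b)"
    unfolding Omega_pow_eq by (rule pm_eq_sym[OF list_pow_add[OF upt_subset]])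
  also have "\<dots> \<doteq> list_pow [1..<Suc N] (\<lambda>b. 0)"
    using assms by (intro list_pow_mod) auto
  finally have "?B ** ?A \<doteq> matrix_inv ?A ** ?A" using inv by (simp add: list_pow_zero)
  then show ?thesis by (rule pm_eq_mult_cancel[OF inv])
qed

text \<open>A generator acts on the \<Omega>^\<alpha> by a cyclic shift of one exponent, up to a
  sign that F ignores. The exponents are permuted rather than the matrices, because different
  \<alpha> may give the same matrix.\<close>

lemma sum_Sigma0_translate:
  fixes F :: "'n cmat \<Rightarrow> 'b::comm_monoid_add"
  assumes a: "a \<in> {1..N}" and F: "\<And>A B. A \<in> G0 \<Longrightarrow> B \<in> G0 \<Longrightarrow> A \<doteq> B \<Longrightarrow> F A = F B"
  shows "(\<Sum>\<alpha>\<in>Sigma0 N m. F (\<Omega> a ** Omega_pow N \<Omega> \<alpha>)) = (\<Sum>\<alpha>\<in>Sigma0 N m. F (Omega_pow N \<Omega> \<alpha>))"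
proof -
  \<comment> \<open>Cyclic shift by k of the exponent of generator a. The inverse of the shift by 1
    is the shift by \<open>m a - 1\<close>, which stands for -1 in the natural numbers.\<close>
  define t where "t k \<alpha> = (\<lambda>b\<in>{1..N}. (\<alpha> b + (if b = a then k else 0)) mod m b)"
    for k and \<alpha> :: "nat \<Rightarrow> nat"
  \<comment> \<open>An exponent vector in the index set has its entry at b below m b, which rules
    out m b = 0.\<close>
  have m_pos: "m b > 0" if "\<alpha> \<in> Sigma0 N m" "b \<in> {1..N}" for \<alpha> b
    using that PiE_mem[of \<alpha> "{1..N}" "\<lambda>a. {0..<m a}" b] by (auto simp: Sigma0_def)
  have t_in: "t k \<alpha> \<in> Sigma0 N m" if "\<alpha> \<in> Sigma0 N m" for k \<alpha>
    using m_pos[OF that] unfolding t_def Sigma0_def by auto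
  have t_t: "t k (t l \<alpha>) = \<alpha>" if "\<alpha> \<in> Sigma0 N m" "k + l = m a" for k l \<alpha>
  proof
    fix b
    show "t k (t l \<alpha>) b = \<alpha> b"
    proof (cases "b \<in> {1..N}")
      case True
      then have "\<alpha> b < m b" using that(1) by (auto simp: Sigma0_def PiE_def Pi_def)
      with True that(2) show ?thesis
        by (auto simp: t_def mod_simps add_ac)
    next
      case False
      with that(1) show ?thesis by (auto simp: t_def Sigma0_def PiE_def extensional_def)
    qed
  qed
  have m_a: "m a - 1 + 1 = m a" "1 + (m a - 1) = m a" if "\<alpha> \<in> Sigma0 N m" for \<alpha>
    using m_pos[OF that a] by auto
  have t_1: "F (Omega_pow N \<Omega> (t 1 \<alpha>)) = F (\<Omega> a ** Omega_pow N \<Omega> \<alpha>)" for \<alpha>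
  proof (intro F Omega_pow_in_G0 G0_mult Omega_in a Omega_pow_unit_add)
    show "t 1 \<alpha> b mod m b = (\<alpha> b + (if b = a then 1 else 0)) mod m b" if "b \<in> {1..N}" for b
      using that by (simp add: t_def)
  qed
  show ?thesis
    by (rule sum.reindex_bij_witness[where j = "t 1" and i = "t (m a - 1)"])
       (use t_t t_in m_a t_1 in blast)+
qed

text \<open>Inversion negates the exponents modulo the orders, again up to a sign that F
  ignores.\<close>

lemma sum_Sigma0_inv:
  fixes F :: "'n cmat \<Rightarrow> 'b::comm_monoid_add"
  assumes F: "\<And>A B. A \<in> G0 \<Longrightarrow> B \<in> G0 \<Longrightarrow> A \<doteq> B \<Longrightarrow> F A = F B"
  shows "(\<Sum>\<alpha>\<in>Sigma0 N m. F (matrix_inv (Omega_pow N \<Omega> \<alpha>))) = (\<Sum>\<alpha>\<in>Sigma0 N m. F (Omega_pow N \<Omega> \<alpha>))"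
proof -
  \<comment> \<open>The reduction matters at \<alpha> b = 0, where the difference is m b itself and
    falls outside the range.\<close>
  define t where "t \<alpha> = (\<lambda>b\<in>{1..N}. (m b - \<alpha> b) mod m b)" for \<alpha> :: "nat \<Rightarrow> nat"
  have less: "\<alpha> b < m b" if "\<alpha> \<in> Sigma0 N m" "b \<in> {1..N}" for \<alpha> b
    using that PiE_mem[of \<alpha> "{1..N}" "\<lambda>a. {0..<m a}" b] by (auto simp: Sigma0_def)
  have t_in: "t \<alpha> \<in> Sigma0 N m" if "\<alpha> \<in> Sigma0 N m" for \<alpha>
    using less[OF that] unfolding t_def Sigma0_def by fastforce
  have t_t: "t (t \<alpha>) = \<alpha>" if "\<alpha> \<in> Sigma0 N m" for \<alpha>
  proof
    fix b
    show "t (t \<alpha>) b = \<alpha> b"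
    proof (cases "b \<in> {1..N}")
      case True
      then show ?thesis using less[OF that True]
        by (cases "\<alpha> b = 0") (auto simp: t_def)
    next
      case False
      with that show ?thesis by (auto simp: t_def Sigma0_def PiE_def extensional_def)
    qed
  qed
  have "(t \<alpha> b + \<alpha> b) mod m b = 0" if "\<alpha> \<in> Sigma0 N m" "b \<in> {1..N}" for \<alpha> b
    using that less[OF that] by (simp add: t_def mod_simps)
  then show ?thesis
    by (intro sum.reindex_bij_witness[where j = t and i = t])
       (auto intro!: t_t t_in F Omega_pow_neg Omega_pow_in_G0 G0_inv)
qed

lemma Dspace_iff:
  "X \<in> Dspace W G0 \<omega> k \<longleftrightarrow> transpose X ** W = - (W ** X) \<and> mat_cnj X = X \<and>
     (\<forall>A\<in>G0. A ** X ** matrix_inv A = (\<omega> A powi k) *\<^sub>M X)"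
  by (simp add: Dspace_def symp_alg_iff)

end

section \<open>Expansions of matrix functions\<close>

text \<open>Entrywise, to match \<open>coeff_at_inf\<close>. The variable will be the local
  parameter t = 1/\<lambda> at infinity.\<close>

definition has_matrix_expansion ::
  "(complex \<Rightarrow> complex^'n^'m) \<Rightarrow> (nat \<Rightarrow> complex^'n^'m) \<Rightarrow> bool" where
  "has_matrix_expansion g c \<longleftrightarrow>
     (\<forall>i j. (\<lambda>t. g t $ i $ j) has_fps_expansion Abs_fps (\<lambda>n. c n $ i $ j))"

lemma analytic_has_matrix_expansion:
  fixes g :: "complex \<Rightarrow> complex^'n^'m"
  assumes "\<And>i j. (\<lambda>t. g t $ i $ j) analytic_on {0}"
  obtains c where "has_matrix_expansion g c"
proof
  let ?c = "\<lambda>n. \<chi> i j. fps_nth (fps_expansion (\<lambda>t. g t $ i $ j) 0) n"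
  show "has_matrix_expansion g ?c"
    unfolding has_matrix_expansion_def
    using analytic_at_imp_has_fps_expansion_0[OF assms] by (simp add: fps_nth_inverse)
qed

lemma eventually_all_iff:
  fixes P :: "'a \<Rightarrow> 'b::finite \<Rightarrow> bool"
  shows "(\<forall>\<^sub>F x in F. \<forall>y. P x y) \<longleftrightarrow> (\<forall>y. \<forall>\<^sub>F x in F. P x y)"
  using eventually_ball_finite_distrib[of UNIV P] by simp

text \<open>Convergence as a series of matrices lets an operator be applied to all entries at once,
  so that symmetries of the function become symmetries of its coefficients. There are finitely many
  entries, hence a common neighbourhood.\<close>

lemma has_matrix_expansion_iff_sums:
  fixes g :: "complex \<Rightarrow> complex^'n^'m"
  shows "has_matrix_expansion g c \<longleftrightarrow> (\<forall>\<^sub>F t in nhds 0. (\<lambda>n. t ^ n *\<^sub>M c n) sums g t)"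
proof -
  have entry: "(\<lambda>t. g t $ i $ j) has_fps_expansion Abs_fps (\<lambda>n. c n $ i $ j) \<longleftrightarrow>
      (\<forall>\<^sub>F t in nhds 0. (\<lambda>n. t ^ n * c n $ i $ j) sums (g t $ i $ j))" for i j
  proof
    assume *: "(\<lambda>t. g t $ i $ j) has_fps_expansion Abs_fps (\<lambda>n. c n $ i $ j)" (is "?f has_fps_expansion ?F")
    have "\<forall>\<^sub>F t in nhds 0. t \<in> eball 0 (fps_conv_radius ?F)"
      using * by (intro eventually_nhds_in_open) (auto simp: has_fps_expansion_def zero_ereal_def)
    moreover have "\<forall>\<^sub>F t in nhds 0. eval_fps ?F t = ?f t"
      using * by (simp add: has_fps_expansion_def)
    ultimately show "\<forall>\<^sub>F t in nhds 0. (\<lambda>n. t ^ n * c n $ i $ j) sums (g t $ i $ j)"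
    proof eventually_elim
      case (elim t)
      then show ?case using sums_eval_fps[of t ?F] by (simp add: mult.commute in_eball_iff)
    qed
  next
    assume "\<forall>\<^sub>F t in nhds 0. (\<lambda>n. t ^ n * c n $ i $ j) sums (g t $ i $ j)"
    then show "(\<lambda>t. g t $ i $ j) has_fps_expansion Abs_fps (\<lambda>n. c n $ i $ j)"
      by (intro has_fps_expansionI) (simp add: mult.commute)
  qed
  have "(\<lambda>n. t ^ n *\<^sub>M c n) sums g t \<longleftrightarrow> (\<forall>i j. (\<lambda>n. t ^ n * c n $ i $ j) sums (g t $ i $ j))" for t
  proof
    assume *: "(\<lambda>n. t ^ n *\<^sub>M c n) sums g t"
    have "(\<lambda>n. (t ^ n *\<^sub>M c n) $ i $ j) sums (g t $ i $ j)" for i j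
      by (intro bounded_linear.sums[OF bounded_linear_vec_nth] *)
    then show "\<forall>i j. (\<lambda>n. t ^ n * c n $ i $ j) sums (g t $ i $ j)" by simp
  next
    assume *: "\<forall>i j. (\<lambda>n. t ^ n * c n $ i $ j) sums (g t $ i $ j)"
    then show "(\<lambda>n. t ^ n *\<^sub>M c n) sums g t"
      unfolding sums_def by (intro vec_tendstoI) (simp add: sum_component)
  qed
  then show ?thesis
    unfolding has_matrix_expansion_def entry by (simp add: eventually_all_iff)
qed

lemma has_matrix_expansion_unique:
  fixes g :: "complex \<Rightarrow> complex^'n^'m"
  assumes "has_matrix_expansion g c" "has_matrix_expansion g d"
  shows "c = d"
proof -
  have "Abs_fps (\<lambda>n. c n $ i $ j) = Abs_fps (\<lambda>n. d n $ i $ j)" for i j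
    using assms by (intro fps_expansion_unique_complex[of "\<lambda>t. g t $ i $ j"])
      (auto simp: has_matrix_expansion_def)
  then show ?thesis by (auto simp: fps_eq_iff vec_eq_iff fun_eq_iff)
qed

text \<open>\<open>bounded_linear\<close> means real linearity only, so compatibility with complex
  multiples is a separate premise. Complex conjugation violates it and is treated below.\<close>

lemma has_matrix_expansion_linear:
  assumes "has_matrix_expansion g c" "bounded_linear T" "\<And>z X. T (z *\<^sub>M X) = z *\<^sub>M T X"
  shows "has_matrix_expansion (\<lambda>t. T (g t)) (\<lambda>n. T (c n))"
  using assms(1) unfolding has_matrix_expansion_iff_sums
  by eventually_elim (use bounded_linear.sums[OF assms(2)] in \<open>fastforce simp: assms(3)\<close>)

text \<open>The source of the grading: the factor w^n divided out here lowers the weight of the n-th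
  coefficient from p to p - n.\<close>

lemma has_matrix_expansion_dilate:
  assumes "has_matrix_expansion g c" 
  shows "has_matrix_expansion (\<lambda>t. g (t / w)) (\<lambda>n. (1 / w ^ n) *\<^sub>M c n)"
proof -
  have "filterlim (\<lambda>t. t / w) (nhds 0) (nhds 0)"
    using tendsto_at_iff_tendsto_nhds[of "\<lambda>t. t * inverse w" 0]
      tendsto_mult_left_zero[OF tendsto_ident_at, of "inverse w" UNIV]
    by (simp add: divide_inverse)
  from eventually_compose_filterlim[OF assms[unfolded has_matrix_expansion_iff_sums] this]
  show ?thesis unfolding has_matrix_expansion_iff_sums
    by eventually_elim (simp add: power_divide)
qed

text \<open>Conjugation is antilinear; conjugating the argument as well keeps the powers of t
  unconjugated.\<close>

lemma has_matrix_expansion_cnj: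
  assumes "has_matrix_expansion g c"
  shows "has_matrix_expansion (\<lambda>t. mat_cnj (g (cnj t))) (\<lambda>n. mat_cnj (c n))"
proof -
  have "filterlim cnj (nhds 0) (nhds 0)"
    using tendsto_at_iff_tendsto_nhds[of cnj 0] tendsto_cnj[OF tendsto_ident_at, of 0 UNIV] by simp
  from eventually_compose_filterlim[OF assms[unfolded has_matrix_expansion_iff_sums] this]
  show ?thesis unfolding has_matrix_expansion_iff_sums
    by eventually_elim (drule bounded_linear.sums[OF bounded_linear_mat_cnj], simp)
qed

lemma has_matrix_expansion_remainder:
  fixes g :: "complex \<Rightarrow> complex^'n^'m"
  assumes "has_matrix_expansion g c"
  shows "((\<lambda>t. (1 / t ^ p) *\<^sub>M (g t - (\<Sum>n\<le>p. t ^ n *\<^sub>M c n))) \<longlongrightarrow> 0) (at 0)"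
proof (intro vec_tendstoI)
  fix i j
  obtain s where s: "s > 0"
    "\<And>t. norm t < s \<Longrightarrow> (\<lambda>n. t ^ n *\<^sub>M c n) sums g t"
    using assms unfolding has_matrix_expansion_iff_sums eventually_nhds_metric by auto
  \<comment> \<open>One more power of t is divided out than the claim asks for. Off 0, h is a power
    series in t and so has a finite limit; the entry in question is t * h.\<close>
  define h where "h t = (g t $ i $ j - (\<Sum>n\<le>p. t ^ n * c n $ i $ j)) / t ^ Suc p" for t
  have "(\<lambda>n. c (n + Suc p) $ i $ j * t ^ n) sums h t" if "t \<noteq> 0" "norm t < s" for t
  proof -
    have "(\<lambda>n. t ^ n * c n $ i $ j) sums (g t $ i $ j)"
      using bounded_linear.sums[OF bounded_linear_vec_nth
          bounded_linear.sums[OF bounded_linear_vec_nth s(2)[OF that(2)]], of i j]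
      by simp
    then have "(\<lambda>n. t ^ (n + Suc p) * c (n + Suc p) $ i $ j) sums
        (g t $ i $ j - (\<Sum>n<Suc p. t ^ n * c n $ i $ j))"
      by (rule sums_split_initial_segment)
    from sums_divide[OF this, of "t ^ Suc p"] that(1) show ?thesis
      by (simp add: h_def power_add lessThan_Suc_atMost field_simps)
  qed
  from powser_limit_0_strong[OF s(1) this] have "(h \<longlongrightarrow> c (0 + Suc p) $ i $ j) (at 0)" by blast
  then have "((\<lambda>t. t * h t) \<longlongrightarrow> 0 * c (0 + Suc p) $ i $ j) (at 0)"
    by (intro tendsto_mult tendsto_ident_at)
  moreover have "\<forall>\<^sub>F t in at 0. t * h t = ((1 / t ^ p) *\<^sub>M (g t - (\<Sum>n\<le>p. t ^ n *\<^sub>M c n))) $ i $ j"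
    unfolding eventually_at_filter
    by (intro always_eventually allI) (simp add: h_def sum_component divide_simps)
  ultimately show "((\<lambda>t. ((1 / t ^ p) *\<^sub>M (g t - (\<Sum>n\<le>p. t ^ n *\<^sub>M c n))) $ i $ j) \<longlongrightarrow> 0 $ i $ j) (at 0)"
    by (auto intro: Lim_transform_eventually)
qed

text \<open>F(1/t) is t^(-p) g(t), so its Laurent series is the power series of g shifted by
  p.\<close>

lemma coeff_at_inf_eq:
  fixes g :: "complex \<Rightarrow> complex^'n^'m"
  assumes "has_matrix_expansion g c"
    and F: "\<And>z. z \<noteq> 0 \<Longrightarrow> F z = z ^ p *\<^sub>M g (1 / z)"
  shows "coeff_at_inf F (int k) = (if k \<le> p then c (p - k) else 0)"
proof -
  have "fls_nth (laurent_expansion (\<lambda>z. F (1 / z) $ i $ j) 0) (- int k)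
      = (if k \<le> p then c (p - k) $ i $ j else 0)" for i j
  proof -
    let ?F = "Abs_fps (\<lambda>n. c n $ i $ j)"
    have "(\<lambda>t. g t $ i $ j) has_laurent_expansion fps_to_fls ?F"
      using assms(1) by (auto simp: has_matrix_expansion_def has_fps_expansion_to_laurent)
    from has_laurent_expansion_shift'[OF this, of "int p"]
    have "(\<lambda>t. F (1 / t) $ i $ j) has_laurent_expansion fls_shift (int p) (fps_to_fls ?F)"
      by (rule has_laurent_expansion_cong[THEN iffD1, rotated 2])
         (auto simp: eventually_at_filter F power_int_minus field_simps intro!: always_eventually)
    then show ?thesis
      by (simp add: laurent_expansion_0_eqI nat_diff_distrib flip: of_nat_diff) 
  qed
  then show ?thesis by (simp add: coeff_at_inf_def vec_eq_iff)
qed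

text \<open>The coefficients vanish beyond \<lambda>^p, so the sum over non-zero coefficients may be
  padded to 0..p. Reversing the index matches the convention of \<open>lam_poly\<close>, leading
  coefficient first.\<close>

lemma plus_part_eq:
  fixes g :: "complex \<Rightarrow> complex^'n^'n"
  assumes "has_matrix_expansion g c"
    and "\<And>z. z \<noteq> 0 \<Longrightarrow> F z = z ^ p *\<^sub>M g (1 / z)"
  shows "plus_part F z = lam_poly p c z"
proof -
  note coeff = coeff_at_inf_eq[OF assms]
  have "plus_part F z = (\<Sum>k\<in>{0..p}. z ^ k *\<^sub>M coeff_at_inf F (int k))"
    unfolding plus_part_def by (rule sum.mono_neutral_left) (auto simp: coeff)
  also have "\<dots> = (\<Sum>k\<in>{0..p}. z ^ k *\<^sub>M c (p - k))"
    by (simp add: coeff)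
  also have "\<dots> = lam_poly p c z"
    unfolding lam_poly_def by (rule sum.reindex_bij_witness[where i = "\<lambda>k. p - k" and j = "\<lambda>k. p - k"]) auto
  finally show ?thesis .
qed

text \<open>Only negative powers of z survive in the difference; with t = 1/z it is minus the
  remainder already estimated at 0.\<close>

lemma lam_poly_minus_tendsto_0:
  fixes g :: "complex \<Rightarrow> complex^'n^'n"
  assumes "has_matrix_expansion g c"
  shows "((\<lambda>z. lam_poly p c z - z ^ p *\<^sub>M g (1 / z)) \<longlongrightarrow> 0) at_infinity"
proof -
  let ?r = "\<lambda>t. (1 / t ^ p) *\<^sub>M (g t - (\<Sum>n\<le>p. t ^ n *\<^sub>M c n))"
  have "((\<lambda>z. ?r (inverse z)) \<longlongrightarrow> 0) at_infinity"
  proof (rule filterlim_compose[of ?r])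
    show "(?r \<longlongrightarrow> 0) (at 0)"
      by (rule has_matrix_expansion_remainder[OF assms])
    show "filterlim inverse (at 0) (at_infinity :: complex filter)"
      by (simp add: filterlim_inverse_at_iff filterlim_ident)
  qed
  from tendsto_minus[OF this] have "((\<lambda>z. - ?r (inverse z)) \<longlongrightarrow> 0) at_infinity"
    by simp
  moreover have "\<forall>\<^sub>F z in at_infinity. - ?r (inverse z) = lam_poly p c z - z ^ p *\<^sub>M g (1 / z)"
    using eventually_not_equal_at_infinity[of 0]
  proof eventually_elim
    case (elim z)
    have "z ^ (p - n) = z ^ p * inverse z ^ n" if "n \<le> p" for n
      using power_diff[OF elim that] by (simp add: divide_inverse power_inverse)
    then have "lam_poly p c z = z ^ p *\<^sub>M (\<Sum>n\<le>p. inverse z ^ n *\<^sub>M c n)"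
      unfolding linear_sum[OF mscale_linear] by (simp add: lam_poly_def atLeast0AtMost)
    moreover have "1 / inverse z ^ p = z ^ p" by (simp add: divide_inverse power_inverse)
    ultimately show ?case
      by (simp add: linear_diff[OF mscale_linear] inverse_eq_divide)
  qed
  ultimately show ?thesis by (rule Lim_transform_eventually)
qed

section \<open>The Lax matrix\<close>

context reduction_group
begin

lemma symp_alg_add: "X \<in> symp_alg W \<Longrightarrow> Y \<in> symp_alg W \<Longrightarrow> X + Y \<in> symp_alg W"
  by (simp add: symp_alg_iff linear_add[OF transpose_linear] matmul.add_left matmul.add_right)

lemma symp_alg_scale: "X \<in> symp_alg W \<Longrightarrow> c *\<^sub>M X \<in> symp_alg W"
  by (simp add: symp_alg_iff mat_scale_minus)

lemma symp_alg_scaleR: "X \<in> symp_alg W \<Longrightarrow> c *\<^sub>R X \<in> symp_alg W"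
  by (simp add: scaleR_eq_mat_scale symp_alg_scale)

lemma symp_alg_sum:
  assumes "\<And>i. i \<in> I \<Longrightarrow> F i \<in> symp_alg W"
  shows "sum F I \<in> symp_alg W"
proof -
  have "0 \<in> symp_alg W"
    by (simp add: symp_alg_iff linear_0[OF transpose_linear] matmul.zero_left matmul.zero_right)
  then show ?thesis
    using assms by (induction I rule: infinite_finite_induct) (auto intro: symp_alg_add)
qed

text \<open>Carrying W across each factor X costs a sign and across \<theta> none, so an odd power
  leaves one sign. Transposition reverses the order of the factors, and commutation of \<theta> with
  X restores it.\<close>

lemma symp_alg_mult_odd_pow:
  assumes X: "X \<in> symp_alg W" and \<theta>: "transpose \<theta> ** W = W ** \<theta>"
    and comm: "\<theta> ** X = X ** \<theta>" and "odd k"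
  shows "\<theta> ** mat_pow X k \<in> symp_alg W"
proof -
  have pow: "transpose (mat_pow X k) ** W = (-1) ^ k *\<^sub>M (W ** mat_pow X k)" for k
  proof (induction k)
    case (Suc k)
    have "transpose (mat_pow X (Suc k)) ** W = transpose X ** (transpose (mat_pow X k) ** W)"
      by (simp only: mat_pow_Suc_right matrix_transpose_mul matrix_mul_assoc)
    also have "\<dots> = (-1) ^ k *\<^sub>M (transpose X ** W ** mat_pow X k)"
      by (simp add: Suc matrix_mul_assoc)
    also have "\<dots> = (-1) ^ Suc k *\<^sub>M (W ** mat_pow X (Suc k))"
      using X by (simp add: symp_alg_iff matmul.minus_left matrix_mul_assoc)
        (simp add: vec_eq_iff)
    finally show ?case .
  qed simp
  have "transpose (\<theta> ** mat_pow X k) ** W = transpose (mat_pow X k) ** (transpose \<theta> ** W)"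
    by (simp add: matrix_transpose_mul matrix_mul_assoc)
  also have "\<dots> = (transpose (mat_pow X k) ** W) ** \<theta>"
    by (simp add: \<theta> matrix_mul_assoc)
  also have "\<dots> = (-1) ^ k *\<^sub>M (W ** (mat_pow X k ** \<theta>))"
    by (simp add: pow matrix_mul_assoc)
  also have "\<dots> = - (W ** (\<theta> ** mat_pow X k))"
    using \<open>odd k\<close> mat_pow_commute[OF comm, of k] by simp
  finally show ?thesis by (simp add: symp_alg_iff)
qed

end

text \<open>The situation at one fixed x: \<open>\<Phi>\<close> is a family of constant
  vectors.\<close>

locale lax_matrix = reduction_generators W G0 \<omega> \<Omega> N m
  for W :: "'n::finite cmat" and G0 \<omega> \<Omega> N m +
  fixes K :: "'n cmat" and \<kappa> :: real and r :: nat and lam :: "nat \<Rightarrow> real"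
    and \<Phi> :: "nat \<Rightarrow> complex^'n"
  assumes K_in: "K \<in> Dspace W G0 \<omega> 1"
    and Phi_real: "\<And>\<sigma> i. \<sigma> \<in> {1..r} \<Longrightarrow> \<Phi> \<sigma> $ i \<in> \<real>"
begin

text \<open>The factor 1/(z - \<mu>) is written as t/(1 - t \<mu>) with t = 1/z. The sum over
  \<alpha> is left out, so that what remains is a function of a matrix A.\<close>

definition pole_part :: "'n cmat \<Rightarrow> complex \<Rightarrow> 'n cmat" where
  "pole_part A t = (\<Sum>\<sigma>=1..r. (t / (1 - t * (\<omega> A * complex_of_real (lam \<sigma>)))) *\<^sub>M rank_one W (\<Phi> \<sigma>) A)"

text \<open>The Lax matrix in the local parameter \<open>t = 1/\<lambda>\<close>, with its regular value at \<open>t = 0\<close>.\<close>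

definition lax_inf :: "complex \<Rightarrow> 'n cmat" where
  "lax_inf t = K + \<kappa> *\<^sub>R (\<Sum>\<alpha>\<in>Sigma0 N m. pole_part (Omega_pow N \<Omega> \<alpha>) t)"

lemma Lax_eq:
  assumes "z \<noteq> 0"
  shows "Lax W N \<Omega> m \<omega> r lam \<kappa> K \<Phi> z = lax_inf (1 / z)"
proof -
  have "1 / (z - u) = (1 / z) / (1 - (1 / z) * u)" for u
    using assms by (auto simp: field_simps)
  then show ?thesis
    by (simp add: Lax_def lax_inf_def pole_part_def rank_one_def omega_pow_eq)
qed

lemma pole_part_pm_eq:
  "A \<in> G0 \<Longrightarrow> B \<in> G0 \<Longrightarrow> A \<doteq> B \<Longrightarrow> pole_part A t = pole_part B t"
  unfolding pole_part_def by (simp add: omega_pm_eq[of A B] rank_one_pm_eq[of A B])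

text \<open>Replacing B by A B multiplies the poles by \<omega> A; rescaling t undoes this and
  leaves one factor \<omega> A from the numerator t.\<close>

lemma conj_pole_part:
  assumes "A \<in> G0" "B \<in> G0"
  shows "A ** pole_part B t ** matrix_inv A = \<omega> A *\<^sub>M pole_part (A ** B) (t / \<omega> A)"
proof -
  have "\<omega> A * ((t / \<omega> A) / (1 - t / \<omega> A * (\<omega> (A ** B) * u))) = t / (1 - t * (\<omega> B * u))" for u
  proof -
    have "t / \<omega> A * (\<omega> (A ** B) * u) = t * (\<omega> B * u)"
      using omega_nz[OF assms(1)] by (simp add: omega_mult assms)
    then show ?thesis using omega_nz[OF assms(1)] by (simp only:) simp
  qed
  then show ?thesis
    unfolding pole_part_def
    by (simp add: matmul.sum_right matmul.sum_left linear_sum[OF mscale_linear] conj_rank_one assms)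
qed

text \<open>\<omega> A lies on the unit circle, so its conjugate is its inverse, and up to sign the
  same holds for A itself. The \<Phi> and the numbers \<open>lam \<sigma>\<close> are real.\<close>

lemma cnj_pole_part:
  assumes "A \<in> G0"
  shows "mat_cnj (pole_part A t) = pole_part (matrix_inv A) (cnj t)"
proof -
  have "cnj (\<omega> A) = \<omega> (matrix_inv A)"
    unfolding omega_inv[OF assms]
    using omega_norm[OF assms] complex_norm_square[of "\<omega> A"]
    by (intro inverse_unique[symmetric]) simp
  moreover have "mat_cnj (rank_one W (\<Phi> \<sigma>) A) = rank_one W (\<Phi> \<sigma>) (matrix_inv A)" if "\<sigma> \<in> {1..r}" for \<sigma>
    using cnj_rank_one[OF Phi_real[OF that]] rank_one_pm_eq[OF cnj_pm_eq_inv[OF assms]] by simp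
  ultimately show ?thesis
    unfolding pole_part_def linear_sum[OF mat_cnj_linear] by (intro sum.cong) simp_all
qed

lemma lax_inf_symp_alg: "lax_inf t \<in> symp_alg W"
proof -
  have "K \<in> symp_alg W" using K_in by (simp add: Dspace_def)
  then show ?thesis unfolding lax_inf_def pole_part_def
    by (intro symp_alg_add symp_alg_scaleR symp_alg_sum symp_alg_scale rank_one_symp_alg)
qed

lemma cnj_lax_inf: "mat_cnj (lax_inf t) = lax_inf (cnj t)"
proof -
  have "mat_cnj (\<Sum>\<alpha>\<in>Sigma0 N m. pole_part (Omega_pow N \<Omega> \<alpha>) t)
      = (\<Sum>\<alpha>\<in>Sigma0 N m. pole_part (matrix_inv (Omega_pow N \<Omega> \<alpha>)) (cnj t))"
    unfolding linear_sum[OF mat_cnj_linear] by (simp add: cnj_pole_part Omega_pow_in_G0)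
  also have "\<dots> = (\<Sum>\<alpha>\<in>Sigma0 N m. pole_part (Omega_pow N \<Omega> \<alpha>) (cnj t))"
    by (intro sum_Sigma0_inv pole_part_pm_eq)
  finally show ?thesis
    using K_in by (simp add: lax_inf_def Dspace_def linear_add[OF mat_cnj_linear] linear_scale[OF mat_cnj_linear])
qed

text \<open>For a generator the sum over \<alpha> is translated, and K acquires the same factor
  \<omega> A because it has weight 1. Induction covers the rest of G0, with t arbitrary since each
  conjugation rescales it.\<close>

lemma conj_lax_inf:
  assumes "A \<in> G0"
  shows "A ** lax_inf t ** matrix_inv A = \<omega> A *\<^sub>M lax_inf (t / \<omega> A)"
  using assms
proof (induction arbitrary: t rule: generator_induct)
  case one
  have "matrix_inv (mat 1 :: 'n cmat) = mat 1" by (intro matrix_inv_unique) simp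
  then show ?case by (simp add: omega_one)
next
  case (generator a)
  let ?A = "\<Omega> a" and ?O = "Omega_pow N \<Omega>"
  have A: "?A \<in> G0" by (rule Omega_in[OF generator])
  have "?A ** (\<Sum>\<alpha>\<in>Sigma0 N m. pole_part (?O \<alpha>) t) ** matrix_inv ?A
      = \<omega> ?A *\<^sub>M (\<Sum>\<alpha>\<in>Sigma0 N m. pole_part (?A ** ?O \<alpha>) (t / \<omega> ?A))"
    by (simp add: matmul.sum_right matmul.sum_left linear_sum[OF mscale_linear] conj_pole_part A
        Omega_pow_in_G0)
  also have "(\<Sum>\<alpha>\<in>Sigma0 N m. pole_part (?A ** ?O \<alpha>) (t / \<omega> ?A))
      = (\<Sum>\<alpha>\<in>Sigma0 N m. pole_part (?O \<alpha>) (t / \<omega> ?A))"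
    by (rule sum_Sigma0_translate[OF generator pole_part_pm_eq])
  finally show ?case
    using K_in A
    by (simp add: lax_inf_def Dspace_def matmul.add_left matmul.add_right matmul.scaleR_left
        matmul.scaleR_right linear_add[OF mscale_linear] linear_scale[OF mscale_linear])
next
  case (inv A)
  \<comment> \<open>The induction hypothesis is taken at the argument that rescaling brings back to
    t, and is then solved for the conjugate by the inverse.\<close>
  have "A ** lax_inf (t * \<omega> A) ** matrix_inv A = \<omega> A *\<^sub>M lax_inf t"
    using inv(2)[of "t * \<omega> A"] omega_nz[OF inv(1)] by simp
  then have "matrix_inv A ** (A ** lax_inf (t * \<omega> A) ** matrix_inv A) ** A
      = \<omega> A *\<^sub>M (matrix_inv A ** lax_inf t ** A)" by simp
  then have "lax_inf (t * \<omega> A) = \<omega> A *\<^sub>M (matrix_inv A ** lax_inf t ** A)"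
    using G0D(1)[OF inv(1)] by (simp add: matrix_mul_assoc)
  moreover have "matrix_inv (matrix_inv A) = A"
    using G0D(1)[OF inv(1)] by (intro matrix_inv_unique) simp
  ultimately show ?case
    using omega_nz[OF inv(1)] by (simp add: omega_inv inv(1) divide_inverse)
next
  case (mult A B)
  have "(A ** B) ** lax_inf t ** matrix_inv (A ** B)
      = A ** (B ** lax_inf t ** matrix_inv B) ** matrix_inv A"
    using mult(1,2) by (simp add: inv_mult matrix_mul_assoc)
  then show ?case using mult by (simp add: omega_mult mult_ac)
next
  case (pm_eq A B)
  show ?case
    using pm_eq(4) omega_pm_eq[OF pm_eq(1-3)] pm_eq_conj[OF pm_eq(3) G0D(1)[OF pm_eq(1)]] by simp
qed

end

lemma mat_poly_eval_sum_monom: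
  fixes \<theta> X :: "'n::finite cmat" and c :: "nat \<Rightarrow> real"
  shows "mat_poly_eval (\<Sum>j=1..s. Polynomial.monom (c (s - j) *\<^sub>R \<theta>) (j - 1)) X
    = (\<Sum>j=1..s. c (s - j) *\<^sub>R (\<theta> ** mat_pow X (j - 1)))"
proof -
  define f where "f = (\<Sum>j=1..s. Polynomial.monom (c (s - j) *\<^sub>R \<theta>) (j - 1))"
  have coeff: "Polynomial.coeff f i = (if i < s then c (s - Suc i) *\<^sub>R \<theta> else 0)" for i
  proof -
    have "Polynomial.coeff f i = (\<Sum>j=1..s. if j = Suc i then c (s - j) *\<^sub>R \<theta> else 0)"
      unfolding f_def coeff_sum by (rule sum.cong) (auto simp: coeff_monom)
    then show ?thesis by simp
  qed
  \<comment> \<open>The degree of f falls below s - 1 when top coefficients vanish, so the sum is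
    first enlarged to a range that contains both.\<close>
  have "mat_poly_eval f X = (\<Sum>i<Suc (Polynomial.degree f) + s. Polynomial.coeff f i ** mat_pow X i)"
    unfolding mat_poly_eval_def
    by (rule sum.mono_neutral_left) (auto simp: coeff_eq_0 matmul.zero_left)
  also have "\<dots> = (\<Sum>i<s. Polynomial.coeff f i ** mat_pow X i)"
    by (rule sum.mono_neutral_right) (auto simp: coeff matmul.zero_left)
  also have "\<dots> = (\<Sum>i<s. c (s - Suc i) *\<^sub>R (\<theta> ** mat_pow X i))"
    by (simp add: coeff matmul.scaleR_left)
  also have "\<dots> = (\<Sum>j=1..s. c (s - j) *\<^sub>R (\<theta> ** mat_pow X (j - 1)))"
    by (rule sum.reindex_bij_witness[where i = "\<lambda>j. j - 1" and j = Suc]) auto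
  finally show ?thesis unfolding f_def .
qed

lemma matrix_mult_analytic:
  fixes F :: "complex \<Rightarrow> complex^'n^'m" and G :: "complex \<Rightarrow> complex^'k^'n"
  assumes "\<And>i j. (\<lambda>t. F t $ i $ j) analytic_on S" "\<And>i j. (\<lambda>t. G t $ i $ j) analytic_on S"
  shows "(\<lambda>t. (F t ** G t) $ i $ j) analytic_on S"
  unfolding matrix_matrix_mult_def using assms by (auto intro!: analytic_intros)

lemma mat_pow_analytic:
  fixes F :: "complex \<Rightarrow> 'n::finite cmat"
  assumes "\<And>i j. (\<lambda>t. F t $ i $ j) analytic_on S"
  shows "(\<lambda>t. mat_pow (F t) k $ i $ j) analytic_on S"
  using assms by (induction k arbitrary: i j) (auto intro!: matrix_mult_analytic)

context lax_matrix
begin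

lemma lax_inf_analytic: "(\<lambda>t. lax_inf t $ i $ j) analytic_on {0}"
  unfolding lax_inf_def pole_part_def by (auto simp: sum_component intro!: analytic_intros)

lemma lax_inf_tendsto: "((\<lambda>z. lax_inf (1 / z)) \<longlongrightarrow> lax_inf 0) at_infinity"
proof (intro vec_tendstoI)
  fix i j
  have "((\<lambda>t. lax_inf t $ i $ j) \<longlongrightarrow> lax_inf 0 $ i $ j) (at 0)"
    using analytic_at_imp_isCont[OF lax_inf_analytic] by (simp add: isCont_def)
  moreover have "filterlim (\<lambda>z. 1 / z) (at 0) (at_infinity :: complex filter)"
    unfolding inverse_eq_divide[symmetric] by (simp add: filterlim_inverse_at_iff filterlim_ident)
  ultimately show "((\<lambda>z. lax_inf (1 / z) $ i $ j) \<longlongrightarrow> lax_inf 0 $ i $ j) at_infinity"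
    by (rule filterlim_compose)
qed

end

section \<open>The matrix f(L) and its symmetries\<close>

locale lax_polynomial = lax_matrix W G0 \<omega> \<Omega> N m K \<kappa> r lam \<Phi>
  for W :: "'n::finite cmat" and G0 \<omega> \<Omega> N m K \<kappa> r lam \<Phi> +
  fixes p s :: nat and h :: int and \<theta> :: "'n cmat" and c :: "nat \<Rightarrow> real"
  assumes theta_in: "\<theta> \<in> Theta W G0 \<omega> h"
    and coeff_cond: "\<And>j. j \<in> {1..s} \<Longrightarrow> c (s - j) \<noteq> 0 \<Longrightarrow>
      even j \<and> [h + int j = int p + 1] (mod int (Lcm (m ` {1..N})))"
begin

text \<open>f(L(\<lambda>)) in the local parameter t = 1/\<lambda>, extended to t = 0.\<close>

definition f_lax :: "complex \<Rightarrow> 'n cmat" where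
  "f_lax t = (\<Sum>j=1..s. c (s - j) *\<^sub>R (\<theta> ** mat_pow (lax_inf t) (j - 1)))"

text \<open>\<theta> is a scalar multiple of some g in G0 with \<omega> g = 1, and conjugation by
  such a g does not rescale the argument of L.\<close>

lemma theta_commute: "\<theta> ** lax_inf t = lax_inf t ** \<theta>"
proof -
  obtain z g where g: "g \<in> G0" "\<theta> = z *\<^sub>M g" "\<omega> g = 1"
    using theta_in by (auto simp: Theta_def)
  then have "g ** lax_inf t ** matrix_inv g = lax_inf t"
    by (simp add: conj_lax_inf)
  then have "g ** lax_inf t = lax_inf t ** g"
    using G0D(1)[OF g(1)] matrix_inv_cancel(2) by metis
  then show ?thesis by (simp add: g)
qed

lemma f_lax_commute: "f_lax t ** lax_inf t = lax_inf t ** f_lax t"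
proof -
  have "\<theta> ** mat_pow (lax_inf t) k ** lax_inf t = lax_inf t ** (\<theta> ** mat_pow (lax_inf t) k)" for k
  proof -
    have "lax_inf t ** (\<theta> ** mat_pow (lax_inf t) k) = \<theta> ** lax_inf t ** mat_pow (lax_inf t) k"
      by (simp add: matrix_mul_assoc theta_commute)
    also have "\<dots> = \<theta> ** (mat_pow (lax_inf t) k ** lax_inf t)"
      by (simp add: mat_pow_commute flip: matrix_mul_assoc)
    finally show ?thesis by (simp add: matrix_mul_assoc)
  qed
  then show ?thesis
    by (simp add: f_lax_def matmul.sum_left matmul.sum_right matmul.scaleR_left matmul.scaleR_right)
qed

lemma f_lax_symp_alg: "f_lax t \<in> symp_alg W"
proof -
  have "transpose \<theta> = W ** \<theta> ** matrix_inv W" using theta_in by (auto simp: Theta_def)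
  then have "transpose \<theta> ** W = W ** \<theta>" using W_inv by simp
  then have "\<theta> ** mat_pow (lax_inf t) (j - 1) \<in> symp_alg W" if "j \<in> {1..s}" "even j" for j
    using that by (intro symp_alg_mult_odd_pow lax_inf_symp_alg theta_commute) auto
  \<comment> \<open>A non-zero coefficient forces j even, hence the exponent j - 1 odd. For a zero
    coefficient, the empty sum provides that 0 is in the algebra.\<close>
  then have "c (s - j) *\<^sub>R (\<theta> ** mat_pow (lax_inf t) (j - 1)) \<in> symp_alg W" if "j \<in> {1..s}" for j
    using coeff_cond[OF that] that symp_alg_sum[of "{}"]
    by (cases "c (s - j) = 0") (auto intro!: symp_alg_scaleR)
  then show ?thesis unfolding f_lax_def by (rule symp_alg_sum)
qed

lemma cnj_f_lax: "mat_cnj (f_lax t) = f_lax (cnj t)"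
proof -
  have "mat_cnj \<theta> = \<theta>" using theta_in by (auto simp: Theta_def)
  then show ?thesis
    by (simp add: f_lax_def linear_sum[OF mat_cnj_linear] linear_scale[OF mat_cnj_linear]
        mat_cnj_mult mat_cnj_pow cnj_lax_inf)
qed

text \<open>\<theta> contributes weight h and the power of L weight j - 1. For a non-zero
  coefficient the total h + j - 1 is congruent to p modulo the least common multiple, and powers of
  \<omega> A depend only on that residue.\<close>

lemma conj_f_lax:
  assumes "A \<in> G0"
  shows "A ** f_lax t ** matrix_inv A = (\<omega> A powi int p) *\<^sub>M f_lax (t / \<omega> A)"
proof -
  let ?L = "lax_inf (t / \<omega> A)"
  have conj_theta: "A ** \<theta> ** matrix_inv A = (\<omega> A powi h) *\<^sub>M \<theta>"
    using theta_in assms by (auto simp: Theta_def)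
  have "A ** (c (s - j) *\<^sub>R (\<theta> ** mat_pow (lax_inf t) (j - 1))) ** matrix_inv A
    = (\<omega> A powi int p) *\<^sub>M (c (s - j) *\<^sub>R (\<theta> ** mat_pow ?L (j - 1)))" if j: "j \<in> {1..s}" for j
  proof (cases "c (s - j) = 0")
    case True
    then show ?thesis by (simp add: matmul.zero_left matmul.zero_right)
  next
    case False
    have inv: "invertible A" by (rule G0D(1)[OF assms])
    have "A ** (\<theta> ** mat_pow (lax_inf t) (j - 1)) ** matrix_inv A
      = (A ** \<theta> ** matrix_inv A) ** (A ** mat_pow (lax_inf t) (j - 1) ** matrix_inv A)"
      using inv by (simp add: matrix_mul_assoc)
    also have "\<dots> = (\<omega> A powi h * \<omega> A ^ (j - 1)) *\<^sub>M (\<theta> ** mat_pow ?L (j - 1))"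
      unfolding conj_mat_pow[OF inv] conj_theta conj_lax_inf[OF assms] mat_pow_scale
      by (simp add: mult.commute)
    also have "\<omega> A powi h * \<omega> A ^ (j - 1) = \<omega> A powi (h + int j - 1)"
    proof -
      have "h + int j - 1 = h + int (j - 1)" using j by (simp add: of_nat_diff)
      moreover have "\<omega> A powi (h + int (j - 1)) = \<omega> A powi h * \<omega> A ^ (j - 1)"
        unfolding power_int_add[OF disjI1[OF omega_nz[OF assms]]] power_int_of_nat ..
      ultimately show ?thesis by metis
    qed
    also have "\<dots> = \<omega> A powi int p"
    proof (rule omega_powi_cong[OF assms])
      have "[h + int j = int p + 1] (mod int (Lcm (m ` {1..N})))"
        using coeff_cond[OF j False] by simp
      from cong_diff[OF this cong_refl[of 1]]
      show "[h + int j - 1 = int p] (mod int (Lcm (m ` {1..N})))" by simp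
    qed
    finally show ?thesis
      by (simp add: matmul.scaleR_left matmul.scaleR_right linear_scale[OF mscale_linear])
  qed
  then show ?thesis
    unfolding f_lax_def matmul.sum_right matmul.sum_left linear_sum[OF mscale_linear]
    by (rule sum.cong[OF refl])
qed

lemma f_lax_analytic: "(\<lambda>t. f_lax t $ i $ j) analytic_on {0}"
proof -
  have "(\<lambda>t. (\<theta> ** mat_pow (lax_inf t) k) $ i $ j) analytic_on {0}" for k
    by (intro matrix_mult_analytic mat_pow_analytic lax_inf_analytic analytic_on_const)
  then show ?thesis
    unfolding f_lax_def
    by (auto simp: sum_component scaleR_conv_of_real[where 'a = complex] intro!: analytic_intros)
qed

text \<open>Each defining condition is an identity between two functions of t built from f(L).
  Expanding both sides and comparing coefficients transfers it to C n; the dilation by \<omega> A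
  accounts for the weight p - n.\<close>

lemma f_lax_expansion_in_Dspace:
  assumes "has_matrix_expansion f_lax C"
  shows "C n \<in> Dspace W G0 \<omega> (int p - int n)"
proof -
  have bl: "bounded_linear (\<lambda>X. transpose X ** W)" "bounded_linear (\<lambda>X. - (W ** X))"
    by (intro bounded_linear_compose[OF matmul.bounded_linear_left bounded_linear_transpose]
        bounded_linear_minus matmul.bounded_linear_right)+
  have "has_matrix_expansion (\<lambda>t. transpose (f_lax t) ** W) (\<lambda>n. transpose (C n) ** W)"
    by (rule has_matrix_expansion_linear[OF assms bl(1)]) simp
  moreover have "has_matrix_expansion (\<lambda>t. - (W ** f_lax t)) (\<lambda>n. - (W ** C n))"
    by (rule has_matrix_expansion_linear[OF assms bl(2)]) (simp add: mat_scale_minus)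
  moreover have "transpose (f_lax t) ** W = - (W ** f_lax t)" for t
    using f_lax_symp_alg by (simp add: symp_alg_iff)
  ultimately have "(\<lambda>n. transpose (C n) ** W) = (\<lambda>n. - (W ** C n))"
    by (auto intro: has_matrix_expansion_unique)
  then have 1: "transpose (C n) ** W = - (W ** C n)" by metis
  have "(\<lambda>n. mat_cnj (C n)) = C"
    using has_matrix_expansion_cnj[OF assms] assms
    by (intro has_matrix_expansion_unique[of f_lax]) (simp_all add: cnj_f_lax)
  then have 2: "mat_cnj (C n) = C n" by metis
  have 3: "A ** C n ** matrix_inv A = (\<omega> A powi (int p - int n)) *\<^sub>M C n" if A: "A \<in> G0" for A
  proof -
    have "bounded_linear (\<lambda>X. A ** X ** matrix_inv A)"
      by (intro bounded_linear_compose[OF matmul.bounded_linear_left matmul.bounded_linear_right])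
    then have "has_matrix_expansion (\<lambda>t. A ** f_lax t ** matrix_inv A) (\<lambda>n. A ** C n ** matrix_inv A)"
      by (rule has_matrix_expansion_linear[OF assms]) simp
    moreover have "has_matrix_expansion (\<lambda>t. (\<omega> A powi int p) *\<^sub>M f_lax (t / \<omega> A))
        (\<lambda>n. (\<omega> A powi int p) *\<^sub>M (1 / \<omega> A ^ n) *\<^sub>M C n)"
      by (rule has_matrix_expansion_linear[OF has_matrix_expansion_dilate[OF assms] bounded_linear_mat_scale])
         (simp add: mult_ac)
    ultimately have "(\<lambda>n. A ** C n ** matrix_inv A) = (\<lambda>n. (\<omega> A powi int p) *\<^sub>M (1 / \<omega> A ^ n) *\<^sub>M C n)"
      unfolding conj_f_lax[OF A] by (rule has_matrix_expansion_unique)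
    then have "A ** C n ** matrix_inv A = (\<omega> A powi int p) *\<^sub>M (1 / \<omega> A ^ n) *\<^sub>M C n" by metis
    then show ?thesis using omega_nz[OF A] by (simp add: power_int_diff)
  qed
  show ?thesis using 1 2 3 by (simp add: Dspace_iff)
qed

end

section \<open>The Lax equation\<close>

context lax_matrix
begin

text \<open>The weight of each coefficient equals the power of z it multiplies. With A =
  \<Omega>^\<alpha> this carries U at \<open>lam \<sigma>\<close>, which drives the flow, to U at
  the corresponding pole.\<close>

lemma conj_lam_poly:
  assumes "\<And>j. j \<in> {0..p} \<Longrightarrow> U j \<in> Dspace W G0 \<omega> (int p - int j)" and A: "A \<in> G0"
  shows "A ** lam_poly p U z ** matrix_inv A = lam_poly p U (\<omega> A * z)"
proof -
  have "A ** (z ^ (p - j) *\<^sub>M U j) ** matrix_inv A = (\<omega> A * z) ^ (p - j) *\<^sub>M U j" if "j \<in> {0..p}" for j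
  proof -
    have "\<omega> A powi (int p - int j) = \<omega> A ^ (p - j)"
      using that by (simp flip: of_nat_diff)
    moreover have "A ** U j ** matrix_inv A = (\<omega> A powi (int p - int j)) *\<^sub>M U j"
      using assms(1)[OF that] A by (simp add: Dspace_def)
    ultimately show ?thesis by (simp add: power_mult_distrib mult.commute)
  qed
  then show ?thesis
    unfolding lam_poly_def matmul.sum_right matmul.sum_left by (rule sum.cong[OF refl])
qed

lemma lam_poly_symp_alg:
  assumes "\<And>j. j \<in> {0..p} \<Longrightarrow> U j \<in> Dspace W G0 \<omega> (int p - int j)"
  shows "lam_poly p U z \<in> symp_alg W"
  unfolding lam_poly_def using assms
  by (intro symp_alg_sum symp_alg_scale) (simp add: Dspace_def)

text \<open>M acts on both factors of \<phi> \<phi>^T. On the left it passes through A and becomes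
  M'; on the right its transpose passes through the transpose of A and then W, which by the Lie
  algebra relation yields -M'.\<close>

lemma rank_one_has_vector_derivative:
  fixes \<phi> :: "real \<Rightarrow> complex^'n"
  assumes \<phi>: "(\<phi> has_vector_derivative M *v \<phi> x) (at x)"
    and A: "A \<in> G0" "A ** M ** matrix_inv A = M'" "M' \<in> symp_alg W"
  shows "((\<lambda>y. rank_one W (\<phi> y) A) has_vector_derivative
     M' ** rank_one W (\<phi> x) A - rank_one W (\<phi> x) A ** M') (at x)"
proof -
  let ?S = "outer (\<phi> x) (\<phi> x)"
  have AM: "A ** M = M' ** A" using A(2) G0D(1)[OF A(1)] by (metis matrix_inv_cancel(2))
  have "bounded_linear (\<lambda>S. A ** S ** transpose A ** W)"
    by (intro bounded_linear_compose[OF matmul.bounded_linear_left]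
        bounded_linear_compose[OF matmul.bounded_linear_left] matmul.bounded_linear_right)
  from bounded_linear.has_vector_derivative[OF this
      bounded_bilinear.has_vector_derivative[OF bounded_bilinear_outer \<phi> \<phi>]]
  have "((\<lambda>y. rank_one W (\<phi> y) A) has_vector_derivative
      A ** (outer (\<phi> x) (M *v \<phi> x) + outer (M *v \<phi> x) (\<phi> x)) ** transpose A ** W) (at x)"
    by (simp add: rank_one_def)
  moreover have "A ** (M ** ?S) ** transpose A ** W = M' ** rank_one W (\<phi> x) A"
    by (simp add: rank_one_def matrix_mul_assoc AM)
  moreover have "A ** (?S ** transpose M) ** transpose A ** W = - (rank_one W (\<phi> x) A ** M')"
  proof -
    have "A ** (?S ** transpose M) ** transpose A ** W = A ** ?S ** transpose (A ** M) ** W"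
      by (simp add: matrix_transpose_mul matrix_mul_assoc)
    also have "\<dots> = A ** ?S ** transpose A ** (transpose M' ** W)"
      by (simp add: AM matrix_transpose_mul matrix_mul_assoc)
    also have "\<dots> = - (rank_one W (\<phi> x) A ** M')"
      using A(3) by (simp add: symp_alg_iff rank_one_def matmul.minus_right matrix_mul_assoc)
    finally show ?thesis .
  qed
  ultimately show ?thesis
    by (simp add: outer_mult_left outer_mult_right matmul.add_left matmul.add_right)
qed

text \<open>The x-derivative of L: each numerator P moves by its commutator with U evaluated at its
  own pole \<mu>, not at z.\<close>

definition lax_velocity :: "nat \<Rightarrow> (nat \<Rightarrow> 'n cmat) \<Rightarrow> complex \<Rightarrow> 'n cmat" where
  "lax_velocity p U z = \<kappa> *\<^sub>R (\<Sum>\<alpha>\<in>Sigma0 N m. \<Sum>\<sigma>=1..r.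
     let \<mu> = omega_pow N \<Omega> \<omega> \<alpha> * complex_of_real (lam \<sigma>);
       P = rank_one W (\<Phi> \<sigma>) (Omega_pow N \<Omega> \<alpha>)
     in (1 / (z - \<mu>)) *\<^sub>M (lam_poly p U \<mu> ** P - P ** lam_poly p U \<mu>))"

text \<open>The poles and K do not depend on x, so only the numerators are differentiated.
  \<open>\<Phi>_eq\<close> identifies the vectors of the locale with the flow at x.\<close>

lemma Lax_has_vector_derivative:
  fixes \<phi> :: "nat \<Rightarrow> real \<Rightarrow> complex^'n"
  assumes U: "\<And>j. j \<in> {0..p} \<Longrightarrow> U j \<in> Dspace W G0 \<omega> (int p - int j)"
    and \<phi>: "\<And>\<sigma>. \<sigma> \<in> {1..r} \<Longrightarrow>
      (\<phi> \<sigma> has_vector_derivative lam_poly p U (complex_of_real (lam \<sigma>)) *v \<phi> \<sigma> x) (at x)"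
    and \<Phi>_eq: "\<Phi> = (\<lambda>\<sigma>. \<phi> \<sigma> x)"
  shows "((\<lambda>y. Lax W N \<Omega> m \<omega> r lam \<kappa> K (\<lambda>\<sigma>. \<phi> \<sigma> y) z) has_vector_derivative lax_velocity p U z) (at x)"
proof -
  have "((\<lambda>y. (1 / (z - omega_pow N \<Omega> \<omega> \<alpha> * complex_of_real (lam \<sigma>))) *\<^sub>M
        rank_one W (\<phi> \<sigma> y) (Omega_pow N \<Omega> \<alpha>)) has_vector_derivative
      (let \<mu> = omega_pow N \<Omega> \<omega> \<alpha> * complex_of_real (lam \<sigma>);
         P = rank_one W (\<Phi> \<sigma>) (Omega_pow N \<Omega> \<alpha>)
       in (1 / (z - \<mu>)) *\<^sub>M (lam_poly p U \<mu> ** P - P ** lam_poly p U \<mu>))) (at x)"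
    if "\<sigma> \<in> {1..r}" for \<alpha> \<sigma>
    unfolding Let_def \<Phi>_eq omega_pow_eq
    using that
    by (intro bounded_linear.has_vector_derivative[OF bounded_linear_mat_scale]
        rank_one_has_vector_derivative[OF \<phi>] conj_lam_poly[OF U] lam_poly_symp_alg[OF U] Omega_pow_in_G0)
  then have "((\<lambda>y. K + \<kappa> *\<^sub>R (\<Sum>\<alpha>\<in>Sigma0 N m. \<Sum>\<sigma>=1..r.
        (1 / (z - omega_pow N \<Omega> \<omega> \<alpha> * complex_of_real (lam \<sigma>))) *\<^sub>M
        rank_one W (\<phi> \<sigma> y) (Omega_pow N \<Omega> \<alpha>))) has_vector_derivative 0 + lax_velocity p U z) (at x)"
    unfolding lax_velocity_def
    by (intro has_vector_derivative_add has_vector_derivative_const has_vector_derivative_sum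
        bounded_linear.has_vector_derivative[OF bounded_linear_scaleR_right]) auto
  then show ?thesis by (simp add: Lax_def rank_one_def)
qed

lemma finite_Lax_poles: "finite (Lax_poles N \<Omega> m \<omega> r lam)"
proof -
  have "Lax_poles N \<Omega> m \<omega> r lam \<subseteq>
    (\<lambda>(\<alpha>, \<sigma>). omega_pow N \<Omega> \<omega> \<alpha> * complex_of_real (lam \<sigma>)) ` (Sigma0 N m \<times> {1..r})"
    by (auto simp: Lax_poles_def)
  then show ?thesis by (rule finite_subset) (simp add: Sigma0_def finite_PiE)
qed

lemma lax_velocity_tendsto_0: "(lax_velocity p U \<longlongrightarrow> 0) at_infinity"
proof -
  have "((\<lambda>z. (1 / (z - \<mu>)) *\<^sub>M X) \<longlongrightarrow> 0) at_infinity" for \<mu> and X :: "'n cmat"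
  proof (intro vec_tendstoI)
    fix i j
    have "filterlim (\<lambda>z. - \<mu> + z) at_infinity at_infinity"
      by (rule tendsto_add_filterlim_at_infinity[OF tendsto_const filterlim_ident])
    then have "((\<lambda>z. inverse (z - \<mu>) * X $ i $ j) \<longlongrightarrow> 0) at_infinity"
      by (intro tendsto_mult_left_zero filterlim_compose[OF tendsto_inverse_0]) simp
    then show "((\<lambda>z. ((1 / (z - \<mu>)) *\<^sub>M X) $ i $ j) \<longlongrightarrow> 0 $ i $ j) at_infinity"
      by (simp add: inverse_eq_divide)
  qed
  then show ?thesis
    unfolding lax_velocity_def Let_def
    by (intro tendsto_eq_intros tendsto_null_sum refl) (auto intro!: tendsto_null_sum)
qed

end

text \<open>Factorization of z^n - w^n in each coefficient. The quotient is an explicit polynomial,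
  hence defined also at z = w, where L may have a pole.\<close>

lemma lam_poly_diff:
  "lam_poly p U z - lam_poly p U w =
     (z - w) *\<^sub>M (\<Sum>j=0..p. (\<Sum>i<p - j. w ^ (p - j - Suc i) * z ^ i) *\<^sub>M U j)"
proof -
  have "z ^ n *\<^sub>M X - w ^ n *\<^sub>M X = (z - w) *\<^sub>M (\<Sum>i<n. w ^ (n - Suc i) * z ^ i) *\<^sub>M X"
    for n and X :: "'a cmat"
    using power_diff_sumr2[of z n w] by (simp add: vec_eq_iff flip: left_diff_distrib)
  then show ?thesis
    unfolding linear_sum[OF mscale_linear] lam_poly_def sum_subtractf[symmetric] by simp
qed

section \<open>Comparison of the commutator with the derivative by Liouville's theorem\<close>

context lax_polynomial
begin

lemma commutator_eq_lax_velocity: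
  assumes C: "has_matrix_expansion f_lax C" and U: "\<And>z. lam_poly p U z = lam_poly p C z"
    and z: "z \<notin> Lax_poles N \<Omega> m \<omega> r lam"
  defines "V \<equiv> lam_poly p U" and "L \<equiv> Lax W N \<Omega> m \<omega> r lam \<kappa> K \<Phi>"
  shows "V z ** L z - L z ** V z = lax_velocity p U z"
proof -
  \<comment> \<open>The difference quotient of V between z and \<mu>, in its polynomial
    form.\<close>
  define Q where "Q \<mu> z = (\<Sum>j=0..p. (\<Sum>i<p - j. \<mu> ^ (p - j - Suc i) * z ^ i) *\<^sub>M U j)" for \<mu> z
  define \<mu> where "\<mu> \<alpha> \<sigma> = omega_pow N \<Omega> \<omega> \<alpha> * complex_of_real (lam \<sigma>)" for \<alpha> \<sigma>
  define P where "P \<alpha> \<sigma> = rank_one W (\<Phi> \<sigma>) (Omega_pow N \<Omega> \<alpha>)" for \<alpha> \<sigma>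
  \<comment> \<open>The entire extension of the commutator of V and L minus the velocity: replacing
    difference quotients by Q removes every denominator. Agreement holds off the poles.\<close>
  define E where "E z = V z ** K - K ** V z + \<kappa> *\<^sub>R (\<Sum>\<alpha>\<in>Sigma0 N m. \<Sum>\<sigma>=1..r.
    Q (\<mu> \<alpha> \<sigma>) z ** P \<alpha> \<sigma> - P \<alpha> \<sigma> ** Q (\<mu> \<alpha> \<sigma>) z)" for z
  have E_eq: "V z ** L z - L z ** V z - lax_velocity p U z = E z"
    if z: "z \<notin> Lax_poles N \<Omega> m \<omega> r lam" for z
  proof -
    have L: "L z = K + \<kappa> *\<^sub>R (\<Sum>\<alpha>\<in>Sigma0 N m. \<Sum>\<sigma>=1..r. (1 / (z - \<mu> \<alpha> \<sigma>)) *\<^sub>M P \<alpha> \<sigma>)"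
      by (simp add: L_def Lax_def \<mu>_def P_def rank_one_def)
    have v: "lax_velocity p U z = \<kappa> *\<^sub>R (\<Sum>\<alpha>\<in>Sigma0 N m. \<Sum>\<sigma>=1..r.
        (1 / (z - \<mu> \<alpha> \<sigma>)) *\<^sub>M (V (\<mu> \<alpha> \<sigma>) ** P \<alpha> \<sigma> - P \<alpha> \<sigma> ** V (\<mu> \<alpha> \<sigma>)))"
      by (simp add: lax_velocity_def \<mu>_def P_def V_def Let_def)
    have term_eq: "(1 / (z - \<mu> \<alpha> \<sigma>)) *\<^sub>M (V z ** P \<alpha> \<sigma>) - (1 / (z - \<mu> \<alpha> \<sigma>)) *\<^sub>M (P \<alpha> \<sigma> ** V z)
        - (1 / (z - \<mu> \<alpha> \<sigma>)) *\<^sub>M (V (\<mu> \<alpha> \<sigma>) ** P \<alpha> \<sigma> - P \<alpha> \<sigma> ** V (\<mu> \<alpha> \<sigma>))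
        = Q (\<mu> \<alpha> \<sigma>) z ** P \<alpha> \<sigma> - P \<alpha> \<sigma> ** Q (\<mu> \<alpha> \<sigma>) z"
      if "\<alpha> \<in> Sigma0 N m" "\<sigma> \<in> {1..r}" for \<alpha> \<sigma>
    proof -
      have "z \<noteq> \<mu> \<alpha> \<sigma>" using z that by (auto simp: Lax_poles_def \<mu>_def)
      then have "Q (\<mu> \<alpha> \<sigma>) z = (1 / (z - \<mu> \<alpha> \<sigma>)) *\<^sub>M (V z - V (\<mu> \<alpha> \<sigma>))"
        by (simp add: V_def lam_poly_diff Q_def)
      then show ?thesis
        by (simp add: matmul.diff_left matmul.diff_right linear_diff[OF mscale_linear])
    qed
    have "V z ** L z - L z ** V z - lax_velocity p U z = V z ** K - K ** V z + \<kappa> *\<^sub>R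
      (\<Sum>\<alpha>\<in>Sigma0 N m. \<Sum>\<sigma>=1..r. (1 / (z - \<mu> \<alpha> \<sigma>)) *\<^sub>M (V z ** P \<alpha> \<sigma>)
        - (1 / (z - \<mu> \<alpha> \<sigma>)) *\<^sub>M (P \<alpha> \<sigma> ** V z)
        - (1 / (z - \<mu> \<alpha> \<sigma>)) *\<^sub>M (V (\<mu> \<alpha> \<sigma>) ** P \<alpha> \<sigma> - P \<alpha> \<sigma> ** V (\<mu> \<alpha> \<sigma>)))"
      unfolding L v sum_subtractf scaleR_diff_right
      by (simp add: matmul.add_left matmul.add_right matmul.scaleR_left matmul.scaleR_right
          matmul.sum_left matmul.sum_right)
    also have "\<dots> = E z"
      unfolding E_def by (simp add: term_eq)
    finally show ?thesis .
  qed
  have E_holo: "(\<lambda>z. E z $ i $ j) holomorphic_on UNIV" for i j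
    unfolding E_def Q_def V_def lam_poly_def matrix_matrix_mult_def
    by (auto simp: sum_component scaleR_conv_of_real[where 'a = complex] intro!: holomorphic_intros)
  have "(E \<longlongrightarrow> 0) at_infinity"
  proof -
    \<comment> \<open>Since f(L) commutes with L, V may be replaced by R in the commutator with L. R
      tends to 0 and L stays bounded at infinity, so this commutator tends to 0 as well.\<close>
    define R where "R z = V z - z ^ p *\<^sub>M f_lax (1 / z)" for z
    have "(R \<longlongrightarrow> 0) at_infinity"
      using lam_poly_minus_tendsto_0[OF C] unfolding R_def V_def U .
    then have "((\<lambda>z. R z ** lax_inf (1 / z) - lax_inf (1 / z) ** R z - lax_velocity p U z) \<longlongrightarrow>
        0 ** lax_inf 0 - lax_inf 0 ** 0 - 0) at_infinity"
      by (intro tendsto_diff matmul.tendsto lax_inf_tendsto lax_velocity_tendsto_0)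
    then have "((\<lambda>z. R z ** lax_inf (1 / z) - lax_inf (1 / z) ** R z - lax_velocity p U z) \<longlongrightarrow> 0) at_infinity"
      by (simp add: matmul.zero_left matmul.zero_right)
    moreover have "\<forall>\<^sub>F z in at_infinity.
        R z ** lax_inf (1 / z) - lax_inf (1 / z) ** R z - lax_velocity p U z = E z"
    proof -
      \<comment> \<open>The point 0 is excluded along with the poles because the passage to t = 1/z
        needs z non-zero.\<close>
      have "\<forall>\<^sub>F z in at_infinity. \<forall>\<mu>\<in>insert 0 (Lax_poles N \<Omega> m \<omega> r lam). z \<noteq> \<mu>"
        using finite_Lax_poles by (intro eventually_ball_finite ballI eventually_not_equal_at_infinity) simp
      then show ?thesis
      proof eventually_elim
        case (elim z)
        then have "E z = V z ** lax_inf (1 / z) - lax_inf (1 / z) ** V z - lax_velocity p U z"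
          using E_eq[of z] Lax_eq[of z] by (auto simp: L_def)
        then show ?case
          by (simp add: R_def matmul.diff_left matmul.diff_right f_lax_commute)
      qed
    qed
    ultimately show ?thesis by (rule Lim_transform_eventually)
  qed
  then have "((\<lambda>z. E z $ i $ j) \<longlongrightarrow> 0) at_infinity" for i j
    using tendsto_vec_nth[OF tendsto_vec_nth] by fastforce
  then have "E z $ i $ j = 0" for i j
    by (rule Liouville_weak[OF E_holo])
  then have "E z = 0" by (simp add: vec_eq_iff)
  then show ?thesis using E_eq[OF z] by simp
qed

end

theorem theorem1:
  fixes W K :: "complex^'n^'n"
    and G0 :: "(complex^'n^'n) set"
    and \<Omega> :: "nat \<Rightarrow> complex^'n^'n"
    and \<omega> :: "complex^'n^'n \<Rightarrow> complex"
    and m :: "nat \<Rightarrow> nat"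
    and lam :: "nat \<Rightarrow> real"
    and \<kappa> :: real
    and n N r p m0 :: nat
    and h :: int
    and f :: "(complex^'n^'n) poly"
    and S :: "real set"
    and U :: "nat \<Rightarrow> real \<Rightarrow> complex^'n^'n"
    and \<Phi> :: "nat \<Rightarrow> real \<Rightarrow> complex^'n"
    and L Util :: "real \<Rightarrow> complex \<Rightarrow> complex^'n^'n"
  assumes dim: "CARD('n) = 2 * n"
    and W_real: "mat_cnj W = W"
    and W_inv: "invertible W"
    and W_antisym: "transpose W = - W"
    and G0_subgroup: "subgroup G0 (symp_group W)"
    and G0_finite: "finite G0"
    and G0_cnj: "\<And>A. A \<in> G0 \<Longrightarrow> mat_cnj A ** A = mat 1 \<or> mat_cnj A ** A = - mat 1"
    and Omega_in: "\<And>a. a \<in> {1..N} \<Longrightarrow> \<Omega> a \<in> G0"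
    and Omega_gen: "generate (proj_group W) (pr W ` \<Omega> ` {1..N}) = pr W ` G0"
    and m_ord: "\<And>a. a \<in> {1..N} \<Longrightarrow> m a = group.ord (proj_group W) (pr W (\<Omega> a))"
    and m0_lcm: "m0 = Lcm (m ` {1..N})"
    and omega_hom: "\<omega> \<in> hom ((symp_group W)\<lparr>carrier := G0\<rparr>) circle_group"
    and omega_pmI: "\<And>A. A \<in> G0 \<inter> pmI \<Longrightarrow> \<omega> A = 1"
    and lam_nz: "\<And>\<sigma>. \<sigma> \<in> {1..r} \<Longrightarrow> lam \<sigma> \<noteq> 0"
    and lam_sq: "inj_on (\<lambda>\<sigma>. (lam \<sigma>)\<^sup>2) {1..r}"
    and p_pos: "p \<ge> 1"
    and f_in: "f \<in> Fpoly W G0 \<omega> m0 (int p) h"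
    and K_in: "K \<in> Dspace W G0 \<omega> 1"
    and S_open: "open S"
    and U_in: "\<And>x j. x \<in> S \<Longrightarrow> j \<in> {0..p} \<Longrightarrow> U j x \<in> Dspace W G0 \<omega> (int p - int j)"
    and Phi_real: "\<And>x \<sigma> i. x \<in> S \<Longrightarrow> \<sigma> \<in> {1..r} \<Longrightarrow> \<Phi> \<sigma> x $ i \<in> \<real>"
    and Phi_ode: "\<And>x \<sigma>. x \<in> S \<Longrightarrow> \<sigma> \<in> {1..r} \<Longrightarrow>
        (\<Phi> \<sigma> has_vector_derivative
           lam_poly p (\<lambda>j. U j x) (complex_of_real (lam \<sigma>)) *v \<Phi> \<sigma> x) (at x)"
    and L_def: "\<And>x z. x \<in> S \<Longrightarrow> L x z = Lax W N \<Omega> m \<omega> r lam \<kappa> K (\<lambda>\<sigma>. \<Phi> \<sigma> x) z"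
    and Util_def: "\<And>x z. x \<in> S \<Longrightarrow>
        Util x z = plus_part (\<lambda>y. y ^ p *\<^sub>M mat_poly_eval f (L x y)) z"
  shows "((\<forall>x\<in>S. \<forall>z. lam_poly p (\<lambda>j. U j x) z = Util x z) \<longrightarrow>
           (\<forall>x\<in>S. \<forall>z. z \<notin> Lax_poles N \<Omega> m \<omega> r lam \<longrightarrow>
             ((\<lambda>y. L y z) has_vector_derivative
                (lam_poly p (\<lambda>j. U j x) z ** L x z - L x z ** lam_poly p (\<lambda>j. U j x) z)) (at x)))
       \<and> (\<forall>x\<in>S. \<exists>V. (\<forall>z. Util x z = lam_poly p V z) \<and>
             (\<forall>j\<in>{0..p}. V j \<in> Dspace W G0 \<omega> (int p - int j)))"
proof -
  obtain s \<theta> c where theta: "\<theta> \<in> Theta W G0 \<omega> h"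
    and c: "\<forall>j\<in>{1..s}. c (s - j) \<noteq> 0 \<longrightarrow> even j \<and> [h + int j = int p + 1] (mod int m0)"
    and f: "f = (\<Sum>j=1..s. Polynomial.monom (c (s - j) *\<^sub>R \<theta>) (j - 1))"
    using f_in unfolding Fpoly_def by blast
  \<comment> \<open>The locale is instantiated separately for each x, with the vectors \<Phi> frozen
    at their values there.\<close>
  have lax_pol: "lax_polynomial W G0 \<omega> \<Omega> N m K r (\<lambda>\<sigma>. \<Phi> \<sigma> x) p s h \<theta> c" if "x \<in> S" for x
    by (intro lax_polynomial.intro lax_matrix.intro reduction_generators.intro reduction_group.intro
        lax_polynomial_axioms.intro lax_matrix_axioms.intro reduction_generators_axioms.intro)
       (fact W_real W_inv W_antisym G0_subgroup G0_cnj omega_hom omega_pmI Omega_in Omega_gen m_ord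
         K_in Phi_real[OF that] theta | use c m0_lcm in blast)+
  \<comment> \<open>One sequence C serves both conclusions: it gives the behaviour of f(L) at
    infinity for the Lax equation, and it is the coefficient sequence claimed for
    \<open>Util\<close>.\<close>
  have expansion: "\<exists>C. has_matrix_expansion (lax_polynomial.f_lax W \<omega> \<Omega> N m K \<kappa> r lam (\<lambda>\<sigma>. \<Phi> \<sigma> x) s \<theta> c) C
      \<and> (\<forall>z. Util x z = lam_poly p C z) \<and> (\<forall>n. C n \<in> Dspace W G0 \<omega> (int p - int n))"
    if x: "x \<in> S" for x
  proof -
    interpret lax_polynomial W G0 \<omega> \<Omega> N m K \<kappa> r lam "\<lambda>\<sigma>. \<Phi> \<sigma> x" p s h \<theta> c
      by (rule lax_pol[OF x])
    obtain C where C: "has_matrix_expansion f_lax C"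
      using analytic_has_matrix_expansion[OF f_lax_analytic] .
    have "y ^ p *\<^sub>M mat_poly_eval f (L x y) = y ^ p *\<^sub>M f_lax (1 / y)" if "y \<noteq> 0" for y
      unfolding f mat_poly_eval_sum_monom L_def[OF x] Lax_eq[OF that] f_lax_def ..
    from plus_part_eq[OF C this] show ?thesis
      using C f_lax_expansion_in_Dspace[OF C] by (auto simp: Util_def[OF x])
  qed
  show ?thesis
  proof (intro conjI impI ballI allI)
    fix x z
    assume eq: "\<forall>x\<in>S. \<forall>z. lam_poly p (\<lambda>j. U j x) z = Util x z"
      and x: "x \<in> S" and z: "z \<notin> Lax_poles N \<Omega> m \<omega> r lam"
    interpret lax_polynomial W G0 \<omega> \<Omega> N m K \<kappa> r lam "\<lambda>\<sigma>. \<Phi> \<sigma> x" p s h \<theta> c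
      by (rule lax_pol[OF x])
    obtain C where C: "has_matrix_expansion f_lax C" "\<And>z. Util x z = lam_poly p C z"
      using expansion[OF x] by blast
    have U: "lam_poly p (\<lambda>j. U j x) z = lam_poly p C z" for z
      using eq x C(2) by simp
    have "((\<lambda>y. Lax W N \<Omega> m \<omega> r lam \<kappa> K (\<lambda>\<sigma>. \<Phi> \<sigma> y) z) has_vector_derivative
        lax_velocity p (\<lambda>j. U j x) z) (at x)"
      by (rule Lax_has_vector_derivative[OF U_in[OF x] Phi_ode[OF x] refl])
    \<comment> \<open>L agrees with the Lax matrix only on S; openness of S makes this enough for
      the derivative at x.\<close>
    then have "((\<lambda>y. L y z) has_vector_derivative lax_velocity p (\<lambda>j. U j x) z) (at x)"
      by (rule has_vector_derivative_transform_within_open[OF _ S_open x]) (simp add: L_def)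
    then show "((\<lambda>y. L y z) has_vector_derivative
        (lam_poly p (\<lambda>j. U j x) z ** L x z - L x z ** lam_poly p (\<lambda>j. U j x) z)) (at x)"
      unfolding L_def[OF x] commutator_eq_lax_velocity[OF C(1) U z] .
  next
    fix x assume "x \<in> S"
    then show "\<exists>V. (\<forall>z. Util x z = lam_poly p V z) \<and>
        (\<forall>j\<in>{0..p}. V j \<in> Dspace W G0 \<omega> (int p - int j))"
      using expansion by blast
  qed
qed

end
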